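(* Let $p\in(0,1)$ be fixed (independent of $n$). For almost all graphs $G$ in the Erdős–Rényi model $G_{n,p}$, the energy of the Harmonic matrix $HI(G)$ satisfies $$\mathscr{E}(HI(G))=(1+o(1))\frac{8}{3\pi}\sqrt{\frac{1-p}{p}}\cdot n^{1/2}.$$
   Context: $G_{n,p}$ is the model of random simple graphs on vertex set $\{1,\dots,n\}$ in which each edge is present independently with probability $p$; $d_i$ is the degree of vertex $i$ in $G=(V,E)$. $HI(G)$ is the $n\times n$ matrix with $(i,j)$-entry $\frac{2}{d_i+d_j}$ if $ij\in E$ and $0$ otherwise. The energy of a real symmetric matrix $A$ with eigenvalues $\lambda_1,\dots,\lambda_n$ is $\mathscr{E}(A)=\sum_{i=1}^n|\lambda_i|$. "Almost all" means with probability tending to $1$ as $n\to\infty$; thus "for almost all graphs, $\mathscr{E}=(1+o(1))g(n)$" means that for every $\varepsilon>0$, $\Pr(|\mathscr{E}/g(n)-1|>\varepsilon)\to0$ as $n\to\infty$. *)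

theory Defs
  imports "HOL-Probability.Product_PMF" "Jordan_Normal_Form.Char_Poly"
begin

text \<open>A simple graph on the vertex set \<open>{1..n}\<close> is represented by its edge set,
  a set of two-element subsets of \<open>{1..n}\<close>.\<close>

definition all_edges :: "nat \<Rightarrow> nat set set" where
  "all_edges n = {e. e \<subseteq> {1..n} \<and> card e = 2}"

definition graph_degree :: "nat set set \<Rightarrow> nat \<Rightarrow> nat" where
  "graph_degree E v = card {e \<in> E. v \<in> e}"

definition Gnp :: "nat \<Rightarrow> real \<Rightarrow> nat set set pmf" where
  "Gnp n p = map_pmf (\<lambda>f. {e \<in> all_edges n. f e})
     (Pi_pmf (all_edges n) False (\<lambda>_. bernoulli_pmf p))"

text \<open>Matrix indices run through \<open>{0..<n}\<close>, so row and column \<open>i\<close> belong to vertex \<open>Suc i\<close>.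
  For \<open>i = j\<close> the set \<open>{Suc i, Suc j}\<close> is a singleton and hence not an edge.\<close>

definition harmonic_matrix :: "nat \<Rightarrow> nat set set \<Rightarrow> real mat" where
  "harmonic_matrix n E = Matrix.mat n n (\<lambda>(i, j).
     if {Suc i, Suc j} \<in> E
     then 2 / (real (graph_degree E (Suc i)) + real (graph_degree E (Suc j))) else 0)"

text \<open>\<open>proots\<close> is the multiset of (here: real) roots, so eigenvalues are counted with
  their multiplicity. This is meant for symmetric matrices, where the multiset contains all
  \<open>n\<close> eigenvalues; for other matrices it ignores the non-real ones.\<close>

definition energy :: "real mat \<Rightarrow> real" where
  "energy A = (\<Sum>x\<in>#proots (char_poly A). \<bar>x\<bar>)"

end

theory Submission
  imports Defs "Jordan_Normal_Form.Schur_Decomposition" "HOL-Probability.Hoeffding"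
    "HOL-Real_Asymp.Real_Asymp"
begin

text \<open>
  When all vertex degrees are close to \<open>n p\<close>, an edge contributes about \<open>1 / (n p)\<close> to the
  Harmonic matrix. So \<open>sqrt n * p\<close> times this matrix is, up to a matrix of small Frobenius norm and a
  multiple of the all-ones matrix, the matrix \<open>X\<close> with off-diagonal entries \<open>(a - p) / sqrt n\<close>,
  where \<open>a\<close> is the 0-1 indicator of the edge. This is a Wigner matrix whose entries have variance
  \<open>v / n\<close> with \<open>v = p (1 - p)\<close>. Its eigenvalues follow the semicircle law of variance \<open>v\<close>, whose
  first absolute moment is \<open>8 sqrt v / (3 pi)\<close>; dividing by \<open>p\<close> gives the constant of the theorem.

  The semicircle law enters through resolvents at the points \<open>i t\<close> with \<open>t > 0\<close> only. There the
  resolvent is bounded by \<open>1 / t\<close>, and these points suffice because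
  \<open>\<bar>x\<bar> = 2 / pi * (\<integral>t. x\<^sup>2 / (x\<^sup>2 + t\<^sup>2))\<close> over \<open>t > 0\<close> (\<open>abs_as_integral\<close>): if \<open>s t\<close> denotes the
  normalized trace of the resolvent at \<open>i t\<close>, the mean absolute eigenvalue is \<open>2 / pi\<close> times the
  integral of \<open>1 - t * Im (s t)\<close>.

  For fixed \<open>t\<close>, the trace for \<open>X\<close> is computed by a discrete integration by parts. A coin \<open>f e\<close> of
  bias \<open>p\<close> satisfies \<open>E ((f e - p) F) = v * E (F (f(e := True)) - F (f(e := False)))\<close>, and the
  resolvent identity turns the difference of two resolvents into a product of resolvents. Applied to
  the trace of \<open>X\<close> times its resolvent, this yields
  \<open>1 + i t E s + v E (s\<^sup>2) = O(1 / sqrt n)\<close> (\<open>stieltjes_approximate_quadratic_equation\<close>). Flipping one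
  coin changes \<open>s\<close> by \<open>O(n powr (-3/2))\<close> only, so the Efron-Stein inequality bounds the variance of
  \<open>s\<close> by \<open>O(1/n)\<close>. Hence \<open>E s\<close> almost solves \<open>1 + i t m + v m\<^sup>2 = 0\<close>; as its imaginary part is
  nonnegative, it is close to the root \<open>i y\<close> with \<open>y > 0\<close> (\<open>stieltjes_mean_error\<close>).

  Hoeffding's inequality and a union bound show that the degrees are uniformly close to \<open>n p\<close> with
  probability tending to 1. On that event the traces for the scaled Harmonic matrix and for \<open>X\<close> have
  a vanishing difference (\<open>stieltjes_harmonic_near_centered\<close>). Dominated convergence in \<open>t\<close>, with a
  majorant coming from the Frobenius norm, then gives convergence in mean of the normalized energy on
  that event, and Markov's inequality gives convergence in probability. The limit is found from an
  explicit antiderivative of \<open>1 - t y\<close> (\<open>semicircle_transform_integral\<close>).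
\<close>

unbundle no vec_syntax

section \<open>Orthogonal diagonalization of real symmetric matrices\<close>

text \<open>Over the complex numbers the characteristic polynomial has a root \<open>a\<close>. With an eigenvector
  \<open>v\<close>, the number \<open>\<Sum>i j. A i j * v j * cnj (v i)\<close> is its own conjugate by symmetry, and it equals
  \<open>a\<close> times the squared norm of \<open>v\<close>; so \<open>a\<close> is real.\<close>

lemma symmetric_real_eigenvalue_exists:
  fixes A :: "real mat"
  assumes A: "A \<in> carrier_mat n n" and sym: "transpose_mat A = A" and n: "n > 0"
  shows "\<exists>e. eigenvalue A e"
proof -
  let ?C = "map_mat complex_of_real A"
  have C: "?C \<in> carrier_mat n n" using A by auto
  have symij: "A $$ (i,j) = A $$ (j,i)" if "i < n" "j < n" for i j
    using that A arg_cong[OF sym, of "\<lambda>B. B $$ (i,j)"] by auto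
  obtain as where as: "char_poly ?C = (\<Prod>a\<leftarrow>as. [:- a, 1:])" "length as = n"
    using char_poly_factorized[OF C] by blast
  then obtain a where a: "a \<in> set as" using n by (cases as) auto
  hence "poly (char_poly ?C) a = 0" unfolding as(1) poly_prod_list
    by (intro prod_list_zero_iff[THEN iffD2]) force
  hence "eigenvalue ?C a" using eigenvalue_root_char_poly[OF C] by blast
  then obtain v where "eigenvector ?C v a" unfolding eigenvalue_def by blast
  hence v: "v \<in> carrier_vec n" "v \<noteq> 0\<^sub>v n" "?C *\<^sub>v v = a \<cdot>\<^sub>v v"
    using A unfolding eigenvector_def by auto
  have row: "(\<Sum>j<n. of_real (A $$ (i,j)) * v $ j) = a * v $ i" if "i < n" for i
  proof -
    have "(?C *\<^sub>v v) $ i = (\<Sum>j<n. of_real (A $$ (i,j)) * v $ j)"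
      using that A v(1) by (simp add: scalar_prod_def lessThan_atLeast0)
    with that v show ?thesis by simp
  qed
  define r where "r = (\<Sum>i<n. (cmod (v $ i))\<^sup>2)"
  have "r \<noteq> 0"
  proof
    assume "r = 0"
    hence "\<forall>i<n. v $ i = 0" unfolding r_def by (subst (asm) sum_nonneg_eq_0_iff) auto
    hence "v = 0\<^sub>v n" using v(1) by auto
    with v(2) show False by simp
  qed
  define S where "S = (\<Sum>i<n. \<Sum>j<n. of_real (A $$ (i,j)) * v $ j * cnj (v $ i))"
  have "S = (\<Sum>i<n. a * v $ i * cnj (v $ i))"
    unfolding S_def by (intro sum.cong refl) (simp add: row[symmetric] sum_distrib_right)
  also have "\<dots> = a * of_real r"
    by (simp add: r_def sum_distrib_left mult.assoc complex_norm_square del: of_real_power)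
  finally have S: "S = a * of_real r" .
  have "cnj S = (\<Sum>i<n. \<Sum>j<n. of_real (A $$ (i,j)) * v $ i * cnj (v $ j))"
    unfolding S_def by (simp add: mult_ac)
  also have "\<dots> = (\<Sum>j<n. \<Sum>i<n. of_real (A $$ (j,i)) * v $ i * cnj (v $ j))"
    by (subst sum.swap) (auto intro!: sum.cong simp: symij)
  also have "\<dots> = S" unfolding S_def by simp
  finally have "cnj a = a" using S \<open>r \<noteq> 0\<close> by simp
  then obtain e where e: "a = of_real e" by (metis Reals_cases Reals_cnj_iff)
  have "of_real (poly (char_poly A) e) = poly (char_poly ?C) a"
    unfolding e of_real_hom.char_poly_hom[OF A] by simp
  also have "\<dots> = 0" by fact
  finally have "poly (char_poly A) e = 0" by simp
  thus ?thesis using eigenvalue_root_char_poly[OF A] by blast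
qed

text \<open>Gram-Schmidt without normalization keeps the first vector of the basis; afterwards the
  columns are scaled to unit length.\<close>

lemma orthonormal_basis_with_first_vector:
  fixes v :: "real vec"
  assumes v: "v \<in> carrier_vec n" "v \<noteq> 0\<^sub>v n"
  shows "\<exists>W c. W \<in> carrier_mat n n \<and> transpose_mat W * W = 1\<^sub>m n \<and> col W 0 = c \<cdot>\<^sub>v v"
proof -
  interpret cof_vec_space n "TYPE(real)" .
  define b where "b = basis_completion v"
  define ws where "ws = gram_schmidt n b"
  have n: "n > 0" using v by (cases n) auto
  from basis_completion[OF v, folded b_def]
  have span_b: "span (set b) = carrier_vec n" and dist_b: "distinct b" 
    and indep: "\<not> lin_dep (set b)" and b: "set b \<subseteq> carrier_vec n" and hdb: "hd b = v" 
    and len_b: "length b = n" by auto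
  from hdb len_b n obtain vs where bv: "b = v # vs" by (cases b) auto
  from gram_schmidt_result[OF b dist_b indep refl, folded ws_def]
  have ws: "set ws \<subseteq> carrier_vec n" "corthogonal ws" "length ws = n" 
    by (auto simp: len_b)
  have hdws: "ws ! 0 = v" using gram_schmidt_hd[OF v(1), of vs, folded bv] ws(3) n
    unfolding ws_def by (metis hd_conv_nth length_0_conv less_irrefl)
  have wsc: "ws ! i \<in> carrier_vec n" if "i < n" for i using ws that by auto
  define nr where "nr i = sqrt (scalar_prod (ws ! i) (ws ! i))" for i
  have orth: "scalar_prod (ws ! i) (ws ! j) = 0 \<longleftrightarrow> i \<noteq> j" if "i < n" "j < n" for i j
    using corthogonalD[OF ws(2), of i j] that ws(3) by simp
  have pos: "scalar_prod (ws ! i) (ws ! i) > 0" if "i < n" for i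
  proof -
    have "scalar_prod (ws ! i) (ws ! i) \<ge> 0" unfolding scalar_prod_def by (intro sum_nonneg) auto
    with orth[OF that that] show ?thesis by simp
  qed
  define W where "W = mat_of_cols n (map (\<lambda>i. (1 / nr i) \<cdot>\<^sub>v (ws ! i)) [0..<n])"
  have W: "W \<in> carrier_mat n n" unfolding W_def by auto
  have colW: "col W i = (1 / nr i) \<cdot>\<^sub>v (ws ! i)" if "i < n" for i
    unfolding W_def using that wsc[OF that] by (subst col_mat_of_cols) auto
  have "transpose_mat W * W = 1\<^sub>m n"
  proof (rule eq_matI)
    fix i j assume ij: "i < dim_row (1\<^sub>m n :: real mat)" "j < dim_col (1\<^sub>m n :: real mat)"
    hence ij: "i < n" "j < n" by auto
    have "(transpose_mat W * W) $$ (i,j) = scalar_prod (col W i) (col W j)"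
      using ij W by simp
    also have "\<dots> = (1 / nr i) * (1 / nr j) * scalar_prod (ws ! i) (ws ! j)"
      using ij wsc[OF ij(1)] wsc[OF ij(2)] by (simp add: colW scalar_prod_smult_distrib[of _ n])
    also have "\<dots> = 1\<^sub>m n $$ (i,j)"
    proof (cases "i = j")
      case True
      have "nr j * nr j = scalar_prod (ws ! j) (ws ! j)"
        unfolding nr_def using pos[OF ij(2)] by simp
      thus ?thesis using True ij pos[OF ij(2)] by simp
    next
      case False
      thus ?thesis using ij orth[OF ij] by simp
    qed
    finally show "(transpose_mat W * W) $$ (i,j) = 1\<^sub>m n $$ (i,j)" .
  qed (use W in auto)
  thus ?thesis using W colW[OF n] hdws by metis
qed

text \<open>Induction on the dimension: in an orthonormal basis that starts with an eigenvector, symmetry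
  makes the first row and the first column vanish off the diagonal, and the remaining block is again
  symmetric.\<close>

lemma symmetric_real_orthogonally_diagonalizable:
  fixes A :: "real mat"
  assumes "A \<in> carrier_mat n n" and "transpose_mat A = A"
  shows "\<exists>U D. U \<in> carrier_mat n n \<and> D \<in> carrier_mat n n \<and> transpose_mat U * U = 1\<^sub>m n \<and>
           diagonal_mat D \<and> A = U * D * transpose_mat U"
  using assms
proof (induction n arbitrary: A)
  case 0
  show ?case using 0 by (intro exI[of _ "1\<^sub>m 0"]) (auto simp: diagonal_mat_def intro!: eq_matI)
next
  case (Suc m A)
  let ?n = "Suc m"
  note A = Suc.prems(1) and sym = Suc.prems(2)
  obtain e where "eigenvalue A e" using symmetric_real_eigenvalue_exists[OF A sym] by auto
  then obtain v where "eigenvector A v e" unfolding eigenvalue_def by blast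
  hence v: "v \<in> carrier_vec ?n" "v \<noteq> 0\<^sub>v ?n" "A *\<^sub>v v = e \<cdot>\<^sub>v v"
    using A unfolding eigenvector_def by auto
  obtain W c where W: "W \<in> carrier_mat ?n ?n" and WW: "transpose_mat W * W = 1\<^sub>m ?n"
    and W0: "col W 0 = c \<cdot>\<^sub>v v"
    using orthonormal_basis_with_first_vector[OF v(1,2)] by blast
  have WW': "W * transpose_mat W = 1\<^sub>m ?n"
    using mat_mult_left_right_inverse[OF _ W WW] W by simp
  define A' where "A' = transpose_mat W * A * W"
  have A': "A' \<in> carrier_mat ?n ?n" using W A unfolding A'_def by auto
  have symA': "transpose_mat A' = A'"
  proof -
    have "transpose_mat A' = transpose_mat W * transpose_mat (transpose_mat W * A)"
      unfolding A'_def using W A by (subst transpose_mult[of _ ?n ?n _ ?n]) auto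
    also have "transpose_mat (transpose_mat W * A) = A * W"
      using W A sym by (subst transpose_mult[of _ ?n ?n _ ?n]) auto
    also have "transpose_mat W * (A * W) = A'" unfolding A'_def
      using W A by (subst assoc_mult_mat[of _ ?n ?n _ ?n _ ?n]) auto
    finally show ?thesis .
  qed
  have A'0: "A' $$ (i, 0) = (if i = 0 then e else 0)" if "i < ?n" for i
  proof -
    have "A' = transpose_mat W * (A * W)" unfolding A'_def
      using W A by (subst assoc_mult_mat[of _ ?n ?n _ ?n _ ?n]) auto
    hence "A' $$ (i, 0) = scalar_prod (col W i) (col (A * W) 0)"
      using that W A by simp
    also have "col (A * W) 0 = e \<cdot>\<^sub>v col W 0"
    proof -
      have "col (A * W) 0 = A *\<^sub>v (c \<cdot>\<^sub>v v)"
        using W A by (subst col_mult2[of _ "?n" "?n" _ "?n"]) (auto simp: W0)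
      also have "\<dots> = c \<cdot>\<^sub>v (A *\<^sub>v v)" using A v(1) by (rule mult_mat_vec)
      finally show ?thesis unfolding v(3) W0 by (simp add: smult_smult_assoc mult.commute)
    qed
    also have "scalar_prod (col W i) (e \<cdot>\<^sub>v col W 0) = e * (transpose_mat W * W) $$ (i, 0)"
      using that W by simp
    finally show ?thesis using that unfolding WW by simp
  qed
  have A'0': "A' $$ (0, i) = (if i = 0 then e else 0)" if "i < ?n" for i
    using A'0[OF that] that A' arg_cong[OF symA', of "\<lambda>B. B $$ (0,i)"] by auto
  define B where "B = Matrix.mat m m (\<lambda>(i,j). A' $$ (Suc i, Suc j))"
  have B: "B \<in> carrier_mat m m" unfolding B_def by auto
  have symB: "transpose_mat B = B"
  proof (rule eq_matI)
    fix i j assume "i < dim_row B" "j < dim_col B"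
    hence ij: "i < m" "j < m" using B by auto
    thus "transpose_mat B $$ (i,j) = B $$ (i,j)"
      using A' arg_cong[OF symA', of "\<lambda>M. M $$ (Suc i, Suc j)"] unfolding B_def by auto
  qed (use B in auto)
  have A'block: "A' = four_block_mat (Matrix.mat 1 1 (\<lambda>_. e)) (0\<^sub>m 1 m) (0\<^sub>m m 1) B" (is "_ = ?F")
  proof (rule eq_matI)
    fix i j assume "i < dim_row ?F" "j < dim_col ?F"
    hence ij: "i < ?n" "j < ?n" using B by auto
    show "A' $$ (i,j) = ?F $$ (i,j)"
      using ij B A'0[of i] A'0'[of j] by (cases i; cases j) (auto simp: B_def)
  qed (use A' B in auto)
  obtain P D where P: "P \<in> carrier_mat m m" and D: "D \<in> carrier_mat m m"
    and PP: "transpose_mat P * P = 1\<^sub>m m" and diag: "diagonal_mat D"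
    and BP: "B = P * D * transpose_mat P"
    using Suc.IH[OF B symB] by blast
  define Q where "Q = four_block_mat (1\<^sub>m 1) (0\<^sub>m 1 m) (0\<^sub>m m 1) P"
  define E where "E = four_block_mat (Matrix.mat 1 1 (\<lambda>_. e)) (0\<^sub>m 1 m) (0\<^sub>m m 1) D"
  have Q: "Q \<in> carrier_mat ?n ?n" and E: "E \<in> carrier_mat ?n ?n"
    unfolding Q_def E_def using P D by auto
  have Qt: "transpose_mat Q = four_block_mat (1\<^sub>m 1) (0\<^sub>m 1 m) (0\<^sub>m m 1) (transpose_mat P)"
    unfolding Q_def using P by (subst transpose_four_block_mat[of _ 1 1 _ m _ m]) auto
  have QQ: "transpose_mat Q * Q = 1\<^sub>m ?n"
    unfolding Qt unfolding Q_def using P PP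
    by (subst mult_four_block_mat[of _ 1 1 _ m _ m _ _ 1 _ m]) (auto intro!: eq_matI simp: less_Suc_eq_0_disj)
  have A'Q: "A' = Q * E * transpose_mat Q"
    unfolding Qt unfolding Q_def E_def A'block BP using P D
    apply (subst mult_four_block_mat[of _ 1 1 _ m _ m _ _ 1 _ m]; (auto)?)
    apply (subst mult_four_block_mat[of _ 1 1 _ m _ m _ _ 1 _ m]; (auto)?)
    done
  have dE: "diagonal_mat E"
    unfolding diagonal_mat_def
  proof (intro allI impI)
    fix i j assume "i < dim_row E" "j < dim_col E" "i \<noteq> j"
    thus "E $$ (i,j) = 0" using diag D unfolding E_def diagonal_mat_def
      by (cases i; cases j) auto
  qed
  define U where "U = W * Q"
  have U: "U \<in> carrier_mat ?n ?n" unfolding U_def using W Q by auto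
  have Ut: "transpose_mat U = transpose_mat Q * transpose_mat W"
    unfolding U_def using W Q by (subst transpose_mult[of _ ?n ?n _ ?n]) auto
  note assoc = assoc_mult_mat[of _ ?n ?n _ ?n _ ?n]
  have UU: "transpose_mat U * U = 1\<^sub>m ?n"
  proof -
    have "transpose_mat U * U = transpose_mat Q * (transpose_mat W * (W * Q))"
      unfolding Ut unfolding U_def using W Q by (subst assoc) auto
    also have "transpose_mat W * (W * Q) = transpose_mat W * W * Q"
      using W Q by (subst assoc) auto
    also have "\<dots> = Q" unfolding WW using Q by simp
    finally show ?thesis using QQ by simp
  qed
  have "W * A' * transpose_mat W = W * (transpose_mat W * (A * (W * transpose_mat W)))"
    unfolding A'_def using W A by (simp add: assoc)
  also have "\<dots> = W * (transpose_mat W * A)" unfolding WW' using A by simp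
  also have "\<dots> = W * transpose_mat W * A" using W A by (subst assoc) auto
  also have "\<dots> = A" unfolding WW' using A by simp
  finally have "A = W * A' * transpose_mat W" by simp
  also have "\<dots> = U * E * transpose_mat U"
    unfolding A'Q Ut unfolding U_def using W Q E by (simp add: assoc)
  finally show ?case using U E UU dE by blast
qed

lemma proots_linear_factors:
  fixes as :: "'a :: idom list"
  shows "proots (\<Prod>a\<leftarrow>as. [:- a, 1:]) = mset as"
proof (induction as)
  case (Cons a as)
  have "(\<Prod>a\<leftarrow>as. [:- a, 1:]) \<noteq> 0" by (auto simp: prod_list_zero_iff)
  thus ?case using Cons by (simp add: proots_mult del: mult_pCons_left)
qed simp

text \<open>Matrices are represented by functions of which only the values at indices below \<open>n\<close> matter,
  so that sums over indices can be manipulated directly. The vector \<open>\<lambda>i. u i k\<close> is the \<open>k\<close>-th member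
  of an orthonormal eigenbasis, with eigenvalue \<open>\<mu> k\<close>.\<close>

definition spectral_data :: "nat \<Rightarrow> (nat \<Rightarrow> nat \<Rightarrow> real) \<Rightarrow> (nat \<Rightarrow> nat \<Rightarrow> real) \<Rightarrow> (nat \<Rightarrow> real) \<Rightarrow> bool" where
  "spectral_data n M u \<mu> \<longleftrightarrow>
     (\<forall>i<n. \<forall>j<n. (\<Sum>k<n. u i k * u j k) = of_bool (i = j)) \<and>
     (\<forall>k<n. \<forall>l<n. (\<Sum>i<n. u i k * u i l) = of_bool (k = l)) \<and>
     (\<forall>i<n. \<forall>j<n. M i j = (\<Sum>k<n. \<mu> k * u i k * u j k))"

lemma spectral_data_exists:
  fixes A :: "real mat"
  assumes A: "A \<in> carrier_mat n n" and sym: "transpose_mat A = A"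
  shows "\<exists>u \<mu>. spectral_data n (\<lambda>i j. A $$ (i,j)) u \<mu> \<and> energy A = (\<Sum>k<n. \<bar>\<mu> k\<bar>)"
proof -
  obtain U D where U: "U \<in> carrier_mat n n" and D: "D \<in> carrier_mat n n"
    and UU: "transpose_mat U * U = 1\<^sub>m n" and diag: "diagonal_mat D"
    and AU: "A = U * D * transpose_mat U"
    using symmetric_real_orthogonally_diagonalizable[OF A sym] by blast
  have UU': "U * transpose_mat U = 1\<^sub>m n"
    using mat_mult_left_right_inverse[OF _ U UU] U by simp
  define u where "u i k = U $$ (i,k)" for i k
  define \<mu> where "\<mu> k = D $$ (k,k)" for k
  have 1: "(\<Sum>k<n. u i k * u j k) = of_bool (i = j)" if "i < n" "j < n" for i j
    using arg_cong[OF UU', of "\<lambda>M. M $$ (i,j)"] that U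
    by (auto simp: scalar_prod_def u_def lessThan_atLeast0)
  have 2: "(\<Sum>i<n. u i k * u i l) = of_bool (k = l)" if "k < n" "l < n" for k l
    using arg_cong[OF UU, of "\<lambda>M. M $$ (k,l)"] that U
    by (auto simp: scalar_prod_def u_def lessThan_atLeast0)
  have 3: "A $$ (i,j) = (\<Sum>k<n. \<mu> k * u i k * u j k)" if ij: "i < n" "j < n" for i j
  proof -
    have UD: "(U * D) $$ (i,k) = u i k * \<mu> k" if k: "k < n" for k
    proof -
      have "(U * D) $$ (i,k) = (\<Sum>l<n. U $$ (i,l) * D $$ (l,k))"
        using ij k U D by (auto simp: scalar_prod_def lessThan_atLeast0)
      also have "\<dots> = (\<Sum>l<n. if l = k then u i k * \<mu> k else 0)"
        using diag D k unfolding diagonal_mat_def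
        by (intro sum.cong refl) (auto simp: u_def \<mu>_def)
      also have "\<dots> = u i k * \<mu> k" using k by simp
      finally show ?thesis .
    qed
    define E where "E = U * D"
    have E: "E \<in> carrier_mat n n" unfolding E_def using U D by auto
    have "A $$ (i,j) = (\<Sum>k<n. (U * D) $$ (i,k) * U $$ (j,k))"
      unfolding AU E_def[symmetric] using ij U E by (auto simp: scalar_prod_def lessThan_atLeast0)
    also have "\<dots> = (\<Sum>k<n. \<mu> k * u i k * u j k)"
      by (intro sum.cong refl) (simp add: UD u_def mult_ac)
    finally show ?thesis .
  qed
  have "similar_mat A D"
    unfolding similar_mat_def
    by (intro exI[of _ U] exI[of _ "transpose_mat U"] similar_mat_witI[of _ _ n])
       (use U D A UU UU' AU in auto)
  hence "char_poly A = char_poly D" by (rule char_poly_similar)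
  also have "\<dots> = (\<Prod>a\<leftarrow>diag_mat D. [:- a, 1:])"
    using diag D by (intro char_poly_upper_triangular[of _ n]) (auto simp: diagonal_mat_def)
  finally have "proots (char_poly A) = mset (diag_mat D)"
    by (simp add: proots_linear_factors)
  hence "energy A = (\<Sum>x\<leftarrow>diag_mat D. \<bar>x\<bar>)"
    unfolding energy_def by (metis mset_map sum_mset_sum_list)
  also have "\<dots> = (\<Sum>k<n. \<bar>\<mu> k\<bar>)"
    using D unfolding diag_mat_def \<mu>_def
    by (simp add: sum_list_distinct_conv_sum_set lessThan_atLeast0 o_def interv_sum_list_conv_sum_set_nat)
  finally show ?thesis using 1 2 3 unfolding spectral_data_def by blast
qed

section \<open>Resolvents on the positive imaginary axis\<close>

lemma spectral_data_scale:
  assumes "spectral_data n M u \<mu>"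
  shows "spectral_data n (\<lambda>i j. c * M i j) u (\<lambda>k. c * \<mu> k)"
  using assms unfolding spectral_data_def by (simp add: sum_distrib_left mult.assoc)

text \<open>The trace of the squared matrix, computed in two ways.\<close>

lemma spectral_data_sum_squares:
  assumes "spectral_data n M u \<mu>"
  shows "(\<Sum>k<n. (\<mu> k)\<^sup>2) = (\<Sum>i<n. \<Sum>j<n. (M i j)\<^sup>2)"
proof -
  have o: "(\<Sum>i<n. u i k * u i l) = of_bool (k = l)" if "k < n" "l < n" for k l
    using assms that unfolding spectral_data_def by blast
  have "(\<Sum>i<n. \<Sum>j<n. (M i j)\<^sup>2) =
      (\<Sum>i<n. \<Sum>j<n. \<Sum>k<n. \<Sum>l<n. \<mu> k * \<mu> l * (u i k * u i l) * (u j k * u j l))"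
    using assms unfolding spectral_data_def
    by (intro sum.cong refl) (simp add: power2_eq_square sum_product mult_ac)
  also have "\<dots> = (\<Sum>i<n. \<Sum>k<n. \<Sum>j<n. \<Sum>l<n. \<mu> k * \<mu> l * (u i k * u i l) * (u j k * u j l))"
    by (intro sum.cong refl sum.swap)
  also have "\<dots> = (\<Sum>i<n. \<Sum>k<n. \<Sum>l<n. \<Sum>j<n. \<mu> k * \<mu> l * (u i k * u i l) * (u j k * u j l))"
    by (intro sum.cong refl sum.swap)
  also have "\<dots> = (\<Sum>i<n. \<Sum>k<n. \<Sum>l<n. \<mu> k * \<mu> l * (u i k * u i l) * of_bool (k = l))"
    by (intro sum.cong refl) (simp add: sum_distrib_left[symmetric] o)
  also have "\<dots> = (\<Sum>i<n. \<Sum>k<n. (\<mu> k)\<^sup>2 * (u i k * u i k))"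
    by (intro sum.cong refl) (simp add: power2_eq_square of_bool_def if_distrib cong: if_cong)
  also have "\<dots> = (\<Sum>k<n. \<Sum>i<n. (\<mu> k)\<^sup>2 * (u i k * u i k))"
    by (rule sum.swap)
  also have "\<dots> = (\<Sum>k<n. (\<mu> k)\<^sup>2)"
    by (intro sum.cong refl) (simp add: sum_distrib_left[symmetric] o)
  finally show ?thesis by simp
qed

lemma sum_mult_of_bool_eq:
  fixes f :: "nat \<Rightarrow> 'a::semiring_1"
  shows "i < n \<Longrightarrow> (\<Sum>k<n. f k * of_bool (k = i)) = f i"
    "i < n \<Longrightarrow> (\<Sum>k<n. f k * of_bool (i = k)) = f i"
    "i < n \<Longrightarrow> (\<Sum>k<n. of_bool (k = i) * f k) = f i"
    "i < n \<Longrightarrow> (\<Sum>k<n. of_bool (i = k) * f k) = f i"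
  by (simp_all add: of_bool_def if_distrib if_distribR cong: if_cong)

text \<open>\<open>R\<close> is the two-sided inverse of \<open>M - z I\<close>.\<close>

definition is_resolvent :: "nat \<Rightarrow> (nat \<Rightarrow> nat \<Rightarrow> real) \<Rightarrow> complex \<Rightarrow> (nat \<Rightarrow> nat \<Rightarrow> complex) \<Rightarrow> bool" where
  "is_resolvent n M z R \<longleftrightarrow>
     (\<forall>i<n. \<forall>j<n. (\<Sum>k<n. (of_real (M i k) - z * of_bool (i = k)) * R k j) = of_bool (i = j)) \<and>
     (\<forall>i<n. \<forall>j<n. (\<Sum>k<n. R i k * (of_real (M k j) - z * of_bool (k = j))) = of_bool (i = j))"

text \<open>The second resolvent identity: multiply \<open>(M0 - z I) - (M1 - z I)\<close> by \<open>R1\<close> from the left and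
  by \<open>R0\<close> from the right.\<close>

lemma resolvent_identity:
  assumes R1: "is_resolvent n M1 z R1" and R0: "is_resolvent n M0 z R0" and ij: "i < n" "j < n"
  shows "R1 i j - R0 i j = (\<Sum>k<n. \<Sum>l<n. R1 i k * of_real (M0 k l - M1 k l) * R0 l j)"
proof -
  have "(\<Sum>k<n. \<Sum>l<n. R1 i k * of_real (M0 k l - M1 k l) * R0 l j) =
      (\<Sum>k<n. \<Sum>l<n. R1 i k * ((of_real (M0 k l) - z * of_bool (k = l)) * R0 l j)) -
      (\<Sum>k<n. \<Sum>l<n. R1 i k * (of_real (M1 k l) - z * of_bool (k = l)) * R0 l j)"
    by (simp add: sum_subtractf[symmetric] algebra_simps)
  also have "(\<Sum>k<n. \<Sum>l<n. R1 i k * ((of_real (M0 k l) - z * of_bool (k = l)) * R0 l j)) =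
      (\<Sum>k<n. R1 i k * of_bool (k = j))"
    using R0 ij unfolding is_resolvent_def
    by (intro sum.cong refl) (simp add: sum_distrib_left[symmetric])
  also have "\<dots> = R1 i j" using ij by (simp add: sum_mult_of_bool_eq)
  also have "(\<Sum>k<n. \<Sum>l<n. R1 i k * (of_real (M1 k l) - z * of_bool (k = l)) * R0 l j) =
      (\<Sum>l<n. \<Sum>k<n. R1 i k * (of_real (M1 k l) - z * of_bool (k = l)) * R0 l j)"
    by (rule sum.swap)
  also have "\<dots> = (\<Sum>l<n. of_bool (i = l) * R0 l j)"
    using R1 ij unfolding is_resolvent_def
    by (intro sum.cong refl) (simp add: sum_distrib_right[symmetric])
  also have "\<dots> = R0 i j" using ij by (simp add: sum_mult_of_bool_eq)
  finally show ?thesis by simp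
qed

lemma is_resolvent_unique:
  assumes "is_resolvent n M z R1" "is_resolvent n M z R0" "i < n" "j < n"
  shows "R1 i j = R0 i j"
  using resolvent_identity[OF assms] by simp

text \<open>For \<open>w = R v\<close> one has \<open>v = M w - i t w\<close>. As the scalar product of \<open>M w\<close> and \<open>w\<close> is real, the
  squared norm of \<open>v\<close> is the sum of those of \<open>M w\<close> and \<open>t w\<close>. All bounds on resolvents below
  come from this one.\<close>

lemma resolvent_contraction:
  assumes sym: "\<And>i j. i < n \<Longrightarrow> j < n \<Longrightarrow> M i j = M j i"
    and R: "is_resolvent n M (\<i> * of_real t) R" and t: "t > 0"
  shows "(\<Sum>i<n. (cmod (\<Sum>j<n. R i j * v j))\<^sup>2) \<le> (\<Sum>j<n. (cmod (v j))\<^sup>2) / t\<^sup>2"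
proof -
  define w where "w i = (\<Sum>j<n. R i j * v j)" for i
  define b where "b i = (\<Sum>k<n. of_real (M i k) * w k)" for i
  have v: "v i = b i - \<i> * of_real t * w i" if i: "i < n" for i
  proof -
    have "b i - \<i> * of_real t * w i = (\<Sum>k<n. (of_real (M i k) - \<i> * of_real t * of_bool (i = k)) * w k)"
      using i by (simp add: b_def left_diff_distrib sum_subtractf mult.assoc 
          sum_distrib_left[symmetric] sum_mult_of_bool_eq)
    also have "\<dots> = (\<Sum>k<n. \<Sum>j<n. (of_real (M i k) - \<i> * of_real t * of_bool (i = k)) * R k j * v j)"
      unfolding w_def by (simp add: sum_distrib_left mult.assoc)
    also have "\<dots> = (\<Sum>j<n. \<Sum>k<n. (of_real (M i k) - \<i> * of_real t * of_bool (i = k)) * R k j * v j)"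
      by (rule sum.swap)
    also have "\<dots> = (\<Sum>j<n. of_bool (i = j) * v j)"
      using R i unfolding is_resolvent_def
      by (intro sum.cong refl) (simp add: sum_distrib_right[symmetric])
    finally show ?thesis using i by (simp add: sum_mult_of_bool_eq)
  qed
  define S where "S = (\<Sum>i<n. b i * cnj (w i))"
  have "cnj S = (\<Sum>i<n. \<Sum>k<n. of_real (M i k) * cnj (w k) * w i)"
    unfolding S_def b_def by (simp add: sum_distrib_right)
  also have "\<dots> = (\<Sum>k<n. \<Sum>i<n. of_real (M k i) * cnj (w k) * w i)"
    by (subst sum.swap) (intro sum.cong refl, simp add: sym)
  also have "\<dots> = S" unfolding S_def b_def by (simp add: sum_distrib_left mult_ac)
  finally have ImS: "Im S = 0" by (metis Reals_cnj_iff complex_is_Real_iff)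
  have "(cmod (v i))\<^sup>2 \<ge> t\<^sup>2 * (cmod (w i))\<^sup>2 - 2 * t * Im (b i * cnj (w i))" if "i < n" for i
  proof -
    have "(cmod (v i))\<^sup>2 = (cmod (b i))\<^sup>2 + t\<^sup>2 * (cmod (w i))\<^sup>2 - 2 * t * Im (b i * cnj (w i))"
      unfolding v[OF that] cmod_power2 by (simp add: power2_eq_square algebra_simps)
    thus ?thesis by simp
  qed
  hence "(\<Sum>i<n. (cmod (v i))\<^sup>2) \<ge> (\<Sum>i<n. t\<^sup>2 * (cmod (w i))\<^sup>2 - 2 * t * Im (b i * cnj (w i)))"
    by (intro sum_mono) auto
  also have "(\<Sum>i<n. t\<^sup>2 * (cmod (w i))\<^sup>2 - 2 * t * Im (b i * cnj (w i))) =
      t\<^sup>2 * (\<Sum>i<n. (cmod (w i))\<^sup>2) - 2 * t * Im S"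
    by (simp only: S_def Im_sum sum_subtractf sum_distrib_left)
  finally have "t\<^sup>2 * (\<Sum>i<n. (cmod (w i))\<^sup>2) \<le> (\<Sum>i<n. (cmod (v i))\<^sup>2)" using ImS by simp
  thus ?thesis using t unfolding w_def by (simp add: field_simps)
qed

lemma resolvent_column_norm_le:
  assumes sym: "\<And>i j. i < n \<Longrightarrow> j < n \<Longrightarrow> M i j = M j i"
    and R: "is_resolvent n M (\<i> * of_real t) R" and t: "t > 0" and j: "j < n"
  shows "(\<Sum>i<n. (cmod (R i j))\<^sup>2) \<le> 1 / t\<^sup>2"
proof -
  have "(\<Sum>i<n. (cmod (\<Sum>k<n. R i k * of_bool (k = j)))\<^sup>2) \<le> (\<Sum>k<n. (cmod (of_bool (k = j)))\<^sup>2) / t\<^sup>2"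
    by (rule resolvent_contraction[OF sym R t])
  also have "(\<Sum>k<n. (cmod (of_bool (k = j)))\<^sup>2) = (1::real)"
  proof -
    have "(\<Sum>k<n. (cmod (of_bool (k = j)))\<^sup>2) = (\<Sum>k<n. 1 * of_bool (k = j) :: real)"
      by (intro sum.cong refl) auto
    thus ?thesis using j by (simp only: sum_mult_of_bool_eq)
  qed
  finally show ?thesis using j by (simp add: sum_mult_of_bool_eq)
qed

lemma resolvent_entry_le:
  assumes sym: "\<And>i j. i < n \<Longrightarrow> j < n \<Longrightarrow> M i j = M j i"
    and R: "is_resolvent n M (\<i> * of_real t) R" and t: "t > 0" and ij: "i < n" "j < n"
  shows "cmod (R i j) \<le> 1 / t"
proof -
  have "(cmod (R i j))\<^sup>2 \<le> (\<Sum>i<n. (cmod (R i j))\<^sup>2)"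
    by (rule member_le_sum) (use ij in auto)
  also have "\<dots> \<le> (1 / t)\<^sup>2" using resolvent_column_norm_le[OF sym R t ij(2)] by (simp add: power_divide)
  finally show ?thesis using t by (meson divide_nonneg_nonneg less_imp_le power2_le_imp_le zero_le_one)
qed

text \<open>The resolvent by functional calculus. The formula provides its existence and expresses its
  trace by the eigenvalues.\<close>

lemma resolvent_from_spectral_data:
  assumes S: "spectral_data n M u \<mu>" and t: "t > 0"
  defines "R \<equiv> \<lambda>i j. \<Sum>k<n. of_real (u i k * u j k) / (of_real (\<mu> k) - \<i> * of_real t)"
  shows "is_resolvent n M (\<i> * of_real t) R"
    and "(\<Sum>i<n. R i i) = (\<Sum>k<n. 1 / (of_real (\<mu> k) - \<i> * of_real t))"
proof -
  let ?z = "\<i> * complex_of_real t"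
  have nz: "of_real (\<mu> k) - ?z \<noteq> 0" for k
    using t by (auto simp: complex_eq_iff)
  have of_real_of_bool': "complex_of_real (of_bool P) = of_bool P" for P by (cases P) auto
  have o1: "(\<Sum>k<n. u i k * u j k) = of_bool (i = j)" if "i < n" "j < n" for i j
    using S that unfolding spectral_data_def by blast
  have o2: "(\<Sum>i<n. u i k * u i l) = of_bool (k = l)" if "k < n" "l < n" for k l
    using S that unfolding spectral_data_def by blast
  have M: "of_real (M i j) - ?z * of_bool (i = j) = (\<Sum>k<n. (of_real (\<mu> k) - ?z) * of_real (u i k * u j k))"
    if "i < n" "j < n" for i j
  proof -
    have "(\<Sum>k<n. (of_real (\<mu> k) - ?z) * of_real (u i k * u j k)) =
       of_real (\<Sum>k<n. \<mu> k * u i k * u j k) - ?z * of_real (\<Sum>k<n. u i k * u j k)"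
      by (simp add: sum_distrib_left sum_subtractf[symmetric] algebra_simps)
    thus ?thesis using S that by (simp add: o1 spectral_data_def)
  qed
  have symR: "R i j = R j i" for i j unfolding R_def by (simp add: mult.commute)
  have 1: "(\<Sum>k<n. (of_real (M i k) - ?z * of_bool (i = k)) * R k j) = of_bool (i = j)"
    if ij: "i < n" "j < n" for i j
  proof -
    have "(\<Sum>k<n. (of_real (M i k) - ?z * of_bool (i = k)) * R k j) =
      (\<Sum>k<n. \<Sum>a<n. \<Sum>b<n. (of_real (\<mu> a) - ?z) / (of_real (\<mu> b) - ?z) * of_real (u i a * u j b) * of_real (u k a * u k b))"
    proof (intro sum.cong refl)
      fix k assume "k \<in> {..<n}"
      hence k: "k < n" by simp
      show "(of_real (M i k) - ?z * of_bool (i = k)) * R k j = (\<Sum>a<n. \<Sum>b<n.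
          (of_real (\<mu> a) - ?z) / (of_real (\<mu> b) - ?z) * of_real (u i a * u j b) * of_real (u k a * u k b))"
        unfolding M[OF ij(1) k] R_def sum_product by (intro sum.cong refl) (simp add: mult_ac)
    qed
    also have "\<dots> = (\<Sum>a<n. \<Sum>b<n. \<Sum>k<n. (of_real (\<mu> a) - ?z) / (of_real (\<mu> b) - ?z) * of_real (u i a * u j b) * of_real (u k a * u k b))"
      by (subst sum.swap, rule sum.cong[OF refl], rule sum.swap)
    also have "\<dots> = (\<Sum>a<n. \<Sum>b<n. ((of_real (\<mu> a) - ?z) / (of_real (\<mu> b) - ?z) * of_real (u i a * u j b)) * of_bool (a = b))"
      by (intro sum.cong refl)
         (simp only: sum_distrib_left[symmetric] of_real_sum[symmetric] o2 lessThan_iff of_real_of_bool')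
    also have "\<dots> = (\<Sum>a<n. of_real (u i a * u j a))"
      by (intro sum.cong refl) (simp only: sum_mult_of_bool_eq lessThan_iff divide_self[OF nz] mult_1)
    also have "\<dots> = of_real (\<Sum>a<n. u i a * u j a)" by simp
    finally show ?thesis using ij by (simp add: o1)
  qed
  have 2: "(\<Sum>k<n. R i k * (of_real (M k j) - ?z * of_bool (k = j))) = of_bool (i = j)"
    if ij: "i < n" "j < n" for i j
  proof -
    have "(\<Sum>k<n. R i k * (of_real (M k j) - ?z * of_bool (k = j))) =
       (\<Sum>k<n. (of_real (M j k) - ?z * of_bool (j = k)) * R k i)"
    proof (intro sum.cong refl)
      fix k assume "k \<in> {..<n}"
      hence "M k j = M j k" using S ij unfolding spectral_data_def by (simp add: mult_ac)
      thus "R i k * (of_real (M k j) - ?z * of_bool (k = j)) = (of_real (M j k) - ?z * of_bool (j = k)) * R k i"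
        unfolding symR[of i k] by (cases "k = j") simp_all
    qed
    also have "\<dots> = of_bool (j = i)" by (rule 1) (use ij in auto)
    finally show ?thesis by (cases "i = j") auto
  qed
  show "is_resolvent n M ?z R" unfolding is_resolvent_def using 1 2 by blast
  have "(\<Sum>i<n. R i i) = (\<Sum>k<n. \<Sum>i<n. of_real (u i k * u i k) / (of_real (\<mu> k) - ?z))"
    unfolding R_def by (rule sum.swap)
  also have "\<dots> = (\<Sum>k<n. 1 / (of_real (\<mu> k) - ?z))"
  proof (intro sum.cong refl)
    fix k assume "k \<in> {..<n}"
    hence "(\<Sum>i<n. of_real (u i k * u i k)) = (1::complex)"
      using o2[of k k] by (simp flip: of_real_sum of_real_mult)
    thus "(\<Sum>i<n. of_real (u i k * u i k) / (of_real (\<mu> k) - ?z)) = 1 / (of_real (\<mu> k) - ?z)"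
      by (simp flip: sum_divide_distrib)
  qed
  finally show "(\<Sum>i<n. R i i) = (\<Sum>k<n. 1 / (of_real (\<mu> k) - ?z))" .
qed

lemma resolvent_exists:
  assumes sym: "\<And>i j. i < n \<Longrightarrow> j < n \<Longrightarrow> M i j = M j i" and t: "t > 0"
  shows "\<exists>R. is_resolvent n M (\<i> * of_real t) R"
proof -
  let ?A = "Matrix.mat n n (\<lambda>(i,j). M i j)"
  have "transpose_mat ?A = ?A" using sym by (intro eq_matI) auto
  then obtain u \<mu> where "spectral_data n (\<lambda>i j. ?A $$ (i,j)) u \<mu>"
    using spectral_data_exists[of ?A n] by auto
  hence "spectral_data n M u \<mu>" unfolding spectral_data_def by auto
  thus ?thesis using resolvent_from_spectral_data(1) t by blast
qed

text \<open>By \<open>is_resolvent_unique\<close> the choice is determined on the indices below \<open>n\<close>.\<close>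

definition resolvent :: "nat \<Rightarrow> (nat \<Rightarrow> nat \<Rightarrow> real) \<Rightarrow> real \<Rightarrow> nat \<Rightarrow> nat \<Rightarrow> complex" where
  "resolvent n M t = (SOME R. is_resolvent n M (\<i> * of_real t) R)"

lemma resolvent_is_resolvent:
  assumes "\<And>i j. i < n \<Longrightarrow> j < n \<Longrightarrow> M i j = M j i" and "t > 0"
  shows "is_resolvent n M (\<i> * of_real t) (resolvent n M t)"
  unfolding resolvent_def by (rule someI_ex[OF resolvent_exists]) (use assms in auto)

text \<open>The transpose of a resolvent of a symmetric matrix is a resolvent as well.\<close>

lemma resolvent_sym:
  assumes sym: "\<And>i j. i < n \<Longrightarrow> j < n \<Longrightarrow> M i j = M j i" and t: "t > 0" and ij: "i < n" "j < n"
  shows "resolvent n M t i j = resolvent n M t j i"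
proof -
  let ?R = "resolvent n M t"
  have R: "is_resolvent n M (\<i> * of_real t) ?R" by (rule resolvent_is_resolvent[OF sym t])
  have eq: "of_real (M k i) - z * of_bool (k = i) = of_real (M i k) - z * of_bool (i = k)"
    if "k < n" "i < n" for k i and z :: complex
    using sym[OF that] by (cases "k = i") auto
  have "is_resolvent n M (\<i> * of_real t) (\<lambda>i j. ?R j i)"
    unfolding is_resolvent_def
  proof (intro conjI allI impI)
    fix i j assume ij: "i < n" "j < n"
    have "(\<Sum>k<n. (of_real (M i k) - \<i> * of_real t * of_bool (i = k)) * ?R j k) =
        (\<Sum>k<n. ?R j k * (of_real (M k i) - \<i> * of_real t * of_bool (k = i)))"
    proof (intro sum.cong refl)
      fix k assume "k \<in> {..<n}"
      hence k: "k < n" by simp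
      show "(of_real (M i k) - \<i> * of_real t * of_bool (i = k)) * ?R j k =
          ?R j k * (of_real (M k i) - \<i> * of_real t * of_bool (k = i))"
        by (rule trans[OF mult.commute arg_cong[OF eq[OF ij(1) k]]])
    qed
    also have "\<dots> = of_bool (j = i)" using R ij unfolding is_resolvent_def by simp
    finally show "(\<Sum>k<n. (of_real (M i k) - \<i> * of_real t * of_bool (i = k)) * ?R j k) = of_bool (i = j)"
      by (cases "i = j") simp_all
    have "(\<Sum>k<n. ?R k i * (of_real (M k j) - \<i> * of_real t * of_bool (k = j))) =
        (\<Sum>k<n. (of_real (M j k) - \<i> * of_real t * of_bool (j = k)) * ?R k i)"
    proof (intro sum.cong refl)
      fix k assume "k \<in> {..<n}"
      hence k: "k < n" by simp
      show "?R k i * (of_real (M k j) - \<i> * of_real t * of_bool (k = j)) =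
          (of_real (M j k) - \<i> * of_real t * of_bool (j = k)) * ?R k i"
        by (metis eq[OF k ij(2)] mult.commute)
    qed
    also have "\<dots> = of_bool (j = i)" using R ij unfolding is_resolvent_def by simp
    finally show "(\<Sum>k<n. ?R k i * (of_real (M k j) - \<i> * of_real t * of_bool (k = j))) = of_bool (i = j)"
      by (cases "i = j") simp_all
  qed
  from is_resolvent_unique[OF this R ij(2,1)] show ?thesis by simp
qed

text \<open>The normalized trace of the resolvent at \<open>i t\<close> is the Stieltjes transform of the empirical
  distribution of the eigenvalues.\<close>

definition stieltjes :: "nat \<Rightarrow> (nat \<Rightarrow> nat \<Rightarrow> real) \<Rightarrow> real \<Rightarrow> complex" where
  "stieltjes n M t = (\<Sum>i<n. resolvent n M t i i) / of_nat n"

lemma stieltjes_spectral_data: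
  assumes S: "spectral_data n M u \<mu>" and t: "t > 0"
  shows "stieltjes n M t = (\<Sum>k<n. 1 / (of_real (\<mu> k) - \<i> * of_real t)) / of_nat n"
proof -
  have sym: "M i j = M j i" if "i < n" "j < n" for i j
    using S that unfolding spectral_data_def by (simp add: mult_ac)
  have "resolvent n M t i i = (\<Sum>k<n. of_real (u i k * u i k) / (of_real (\<mu> k) - \<i> * of_real t))"
    if "i < n" for i
    by (rule is_resolvent_unique[OF resolvent_is_resolvent[OF sym t]
          resolvent_from_spectral_data(1)[OF S t] that that])
  thus ?thesis unfolding stieltjes_def
    using resolvent_from_spectral_data(2)[OF S t] by simp
qed

lemma Im_stieltjes_spectral_data:
  assumes S: "spectral_data n M u \<mu>" and t: "t > 0"
  shows "Im (stieltjes n M t) = (\<Sum>k<n. t / ((\<mu> k)\<^sup>2 + t\<^sup>2)) / n"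
proof -
  have "Im (1 / (of_real x - \<i> * of_real t)) = t / (x\<^sup>2 + t\<^sup>2)" for x
    by (simp add: Im_divide)
  thus ?thesis unfolding stieltjes_spectral_data[OF S t] by (simp add: Im_divide_of_nat)
qed

lemma Im_stieltjes_nonneg:
  assumes sym: "\<And>i j. i < n \<Longrightarrow> j < n \<Longrightarrow> M i j = M j i" and t: "t > 0"
  shows "Im (stieltjes n M t) \<ge> 0"
proof -
  let ?A = "Matrix.mat n n (\<lambda>(i,j). M i j)"
  have "transpose_mat ?A = ?A" using sym by (intro eq_matI) auto
  then obtain u \<mu> where "spectral_data n (\<lambda>i j. ?A $$ (i,j)) u \<mu>"
    using spectral_data_exists[of ?A n] by auto
  hence "spectral_data n M u \<mu>" unfolding spectral_data_def by auto
  thus ?thesis using t by (simp add: Im_stieltjes_spectral_data sum_nonneg)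
qed

lemma sum_cmod_mult_le:
  assumes "(\<Sum>i\<in>A. (cmod (x i))\<^sup>2) \<le> c" "(\<Sum>i\<in>A. (cmod (y i))\<^sup>2) \<le> c"
  shows "(\<Sum>i\<in>A. cmod (x i * y i)) \<le> c"
proof -
  have "(\<Sum>i\<in>A. cmod (x i * y i)) \<le> (\<Sum>i\<in>A. ((cmod (x i))\<^sup>2 + (cmod (y i))\<^sup>2) / 2)"
    by (intro sum_mono) (use sum_squares_bound[of "cmod (x _)" "cmod (y _)"] in \<open>simp add: norm_mult field_simps\<close>)
  also have "\<dots> = ((\<Sum>i\<in>A. (cmod (x i))\<^sup>2) + (\<Sum>i\<in>A. (cmod (y i))\<^sup>2)) / 2"
    by (simp add: sum_divide_distrib sum.distrib add_divide_distrib)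
  also have "\<dots> \<le> c" using assms by simp
  finally show ?thesis .
qed

context
  fixes n a b :: nat and c t :: real and M1 M0 :: "nat \<Rightarrow> nat \<Rightarrow> real"
  assumes sym1: "\<And>i j. i < n \<Longrightarrow> j < n \<Longrightarrow> M1 i j = M1 j i"
    and sym0: "\<And>i j. i < n \<Longrightarrow> j < n \<Longrightarrow> M0 i j = M0 j i"
    and t: "t > 0" and ab: "a < n" "b < n"
    and diff: "\<And>i j. i < n \<Longrightarrow> j < n \<Longrightarrow>
      M1 i j - M0 i j = c * (of_bool (i = a \<and> j = b) + of_bool (i = b \<and> j = a))"
begin

text \<open>Flipping one edge of a graph changes the symmetric entries at \<open>(a, b)\<close> and \<open>(b, a)\<close> by the same
  amount \<open>c\<close>, and the resolvent identity reduces to two terms.\<close>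

lemma resolvent_two_entry_perturbation:
  assumes ij: "i < n" "j < n"
  shows "resolvent n M1 t i j - resolvent n M0 t i j =
    - of_real c * (resolvent n M1 t i a * resolvent n M0 t b j + resolvent n M1 t i b * resolvent n M0 t a j)"
proof -
  let ?R1 = "resolvent n M1 t" and ?R0 = "resolvent n M0 t"
  have "?R1 i j - ?R0 i j = (\<Sum>k<n. \<Sum>l<n. ?R1 i k * of_real (M0 k l - M1 k l) * ?R0 l j)"
    by (rule resolvent_identity[OF resolvent_is_resolvent[OF sym1 t] resolvent_is_resolvent[OF sym0 t] ij])
  also have "\<dots> = (\<Sum>k<n. \<Sum>l<n. (- of_real c * (?R1 i k * ?R0 l j) * of_bool (l = b)) * of_bool (k = a)
       + (- of_real c * (?R1 i k * ?R0 l j) * of_bool (l = a)) * of_bool (k = b))"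
  proof (intro sum.cong refl)
    fix k l assume "k \<in> {..<n}" "l \<in> {..<n}"
    hence "M0 k l - M1 k l = - c * (of_bool (k = a \<and> l = b) + of_bool (k = b \<and> l = a))"
      using diff[of k l] by simp
    thus "?R1 i k * of_real (M0 k l - M1 k l) * ?R0 l j =
       (- of_real c * (?R1 i k * ?R0 l j) * of_bool (l = b)) * of_bool (k = a)
       + (- of_real c * (?R1 i k * ?R0 l j) * of_bool (l = a)) * of_bool (k = b)"
      by auto
  qed
  also have "\<dots> = - of_real c * (?R1 i a * ?R0 b j) + - of_real c * (?R1 i b * ?R0 a j)"
    using ab by (simp only: sum.distrib sum_distrib_right[symmetric] sum_mult_of_bool_eq)
  finally show ?thesis by (simp add: algebra_simps)
qed

lemma resolvent_two_entry_perturbation_entry: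
  assumes ij: "i < n" "j < n"
  shows "cmod (resolvent n M1 t i j - resolvent n M0 t i j) \<le> 2 * \<bar>c\<bar> / t\<^sup>2"
proof -
  let ?R1 = "resolvent n M1 t" and ?R0 = "resolvent n M0 t"
  have R1: "cmod (?R1 k l) \<le> 1 / t" if "k < n" "l < n" for k l
    by (rule resolvent_entry_le[OF sym1 resolvent_is_resolvent[OF sym1 t] t that])
  have R0: "cmod (?R0 k l) \<le> 1 / t" if "k < n" "l < n" for k l
    by (rule resolvent_entry_le[OF sym0 resolvent_is_resolvent[OF sym0 t] t that])
  have "cmod (?R1 i a * ?R0 b j + ?R1 i b * ?R0 a j) \<le> 1/t * (1/t) + 1/t * (1/t)"
    by (intro norm_triangle_mono; unfold norm_mult; intro mult_mono R1 R0) (use t ij ab in auto)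
  hence "\<bar>c\<bar> * cmod (?R1 i a * ?R0 b j + ?R1 i b * ?R0 a j) \<le> \<bar>c\<bar> * (2 / t\<^sup>2)"
    by (intro mult_left_mono) (auto simp: power2_eq_square)
  thus ?thesis unfolding resolvent_two_entry_perturbation[OF ij] by (simp add: norm_mult mult.commute)
qed

text \<open>The factor \<open>1 / n\<close>, which the entrywise bound lacks, is gained because the trace of the change
  is \<open>c\<close> times a sum of two scalar products of columns of resolvents, hence bounded independently of
  \<open>n\<close>.\<close>

lemma stieltjes_two_entry_perturbation:
  "cmod (stieltjes n M1 t - stieltjes n M0 t) \<le> 2 * \<bar>c\<bar> / (n * t\<^sup>2)"
proof -
  let ?R1 = "resolvent n M1 t" and ?R0 = "resolvent n M0 t"
  have col1: "(\<Sum>i<n. (cmod (?R1 i j))\<^sup>2) \<le> 1 / t\<^sup>2" if "j < n" for j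
    by (rule resolvent_column_norm_le[OF sym1 resolvent_is_resolvent[OF sym1 t] t that])
  have col0: "(\<Sum>i<n. (cmod (?R0 i j))\<^sup>2) \<le> 1 / t\<^sup>2" if "j < n" for j
    by (rule resolvent_column_norm_le[OF sym0 resolvent_is_resolvent[OF sym0 t] t that])
  have row0: "(\<Sum>i<n. (cmod (?R0 j i))\<^sup>2) \<le> 1 / t\<^sup>2" if "j < n" for j
  proof -
    have "(\<Sum>i<n. (cmod (?R0 j i))\<^sup>2) = (\<Sum>i<n. (cmod (?R0 i j))\<^sup>2)"
      by (intro sum.cong refl) (simp add: resolvent_sym[OF sym0 t that])
    thus ?thesis using col0[OF that] by simp
  qed
  have "cmod (\<Sum>i<n. ?R1 i i - ?R0 i i) =
     cmod (\<Sum>i<n. - of_real c * (?R1 i a * ?R0 b i + ?R1 i b * ?R0 a i))"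
    by (rule arg_cong[of _ _ cmod], intro sum.cong refl)
       (simp only: lessThan_iff resolvent_two_entry_perturbation)
  also have "\<dots> \<le> \<bar>c\<bar> * ((\<Sum>i<n. cmod (?R1 i a * ?R0 b i)) + (\<Sum>i<n. cmod (?R1 i b * ?R0 a i)))"
    unfolding sum_distrib_left[symmetric] norm_mult[of "- of_real c"]
    by (auto intro!: mult_left_mono norm_triangle_mono norm_sum simp: sum.distrib)
  also have "\<dots> \<le> \<bar>c\<bar> * (1 / t\<^sup>2 + 1 / t\<^sup>2)"
    by (intro mult_left_mono add_mono sum_cmod_mult_le col1 row0) (use ab in auto)
  finally have "cmod (\<Sum>i<n. ?R1 i i - ?R0 i i) / n \<le> \<bar>c\<bar> * (1 / t\<^sup>2 + 1 / t\<^sup>2) / n"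
    by (intro divide_right_mono) auto
  thus ?thesis unfolding stieltjes_def
    by (simp add: diff_divide_distrib[symmetric] sum_subtractf norm_divide mult.commute)
qed

end

section \<open>Functions of independent coin flips\<close>

abbreviation bernoulli_product :: "'a set \<Rightarrow> real \<Rightarrow> ('a \<Rightarrow> bool) pmf" where
  "bernoulli_product A p \<equiv> Pi_pmf A False (\<lambda>_. bernoulli_pmf p)"

lemma finite_set_bernoulli_product: "finite A \<Longrightarrow> finite (set_pmf (bernoulli_product A p))"
  by (rule finite_subset[OF set_Pi_pmf_subset']) (auto intro!: finite_PiE_dflt)

lemma integrable_bernoulli_product:
  fixes F :: "_ \<Rightarrow> 'b :: {banach, second_countable_topology}"
  shows "finite A \<Longrightarrow> integrable (measure_pmf (bernoulli_product A p)) F"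
  by (intro integrable_measure_pmf_finite finite_set_bernoulli_product)

text \<open>Conditioning on a single coin; this drives the inductions over the set of coins.\<close>

lemma expectation_bernoulli_product_insert:
  fixes F :: "('a \<Rightarrow> bool) \<Rightarrow> 'b :: {banach, second_countable_topology}"
  assumes A: "finite A" "e \<notin> A" and p: "0 \<le> p" "p \<le> 1"
  shows "measure_pmf.expectation (bernoulli_product (insert e A) p) F =
     p *\<^sub>R measure_pmf.expectation (bernoulli_product A p) (\<lambda>f. F (f(e := True))) +
     (1 - p) *\<^sub>R measure_pmf.expectation (bernoulli_product A p) (\<lambda>f. F (f(e := False)))"
proof -
  have fin: "finite (set_pmf (bernoulli_pmf p))" by simp
  have "measure_pmf.expectation (bernoulli_product (insert e A) p) F =
     measure_pmf.expectation (bernoulli_pmf p \<bind> (\<lambda>y. map_pmf (\<lambda>f. f(e := y)) (bernoulli_product A p))) F"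
    using A by (simp add: Pi_pmf_insert' map_pmf_def)
  also have "\<dots> = measure_pmf.expectation (bernoulli_pmf p)
      (\<lambda>y. measure_pmf.expectation (map_pmf (\<lambda>f. f(e := y)) (bernoulli_product A p)) F)"
    using A by (subst pmf_expectation_bind[of UNIV])
      (auto intro: finite_set_bernoulli_product simp: integral_measure_pmf[of UNIV])
  also have "\<dots> = p *\<^sub>R measure_pmf.expectation (bernoulli_product A p) (\<lambda>f. F (f(e := True))) +
     (1 - p) *\<^sub>R measure_pmf.expectation (bernoulli_product A p) (\<lambda>f. F (f(e := False)))"
    using p by (subst integral_measure_pmf[of UNIV]) (auto simp: UNIV_bool)
  finally show ?thesis .
qed

text \<open>For a coin of bias \<open>p\<close>, the centered value is \<open>1 - p\<close> with probability \<open>p\<close> and \<open>- p\<close> with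
  probability \<open>1 - p\<close>. The two contributions have opposite weights \<open>p * (1 - p)\<close>. This replaces the
  Gaussian integration by parts, without a remainder.\<close>

lemma bernoulli_integration_by_parts:
  fixes F :: "('a \<Rightarrow> bool) \<Rightarrow> complex"
  assumes A: "finite A" "e \<in> A" and p: "0 \<le> p" "p \<le> 1"
  shows "measure_pmf.expectation (bernoulli_product A p) (\<lambda>f. (of_bool (f e) - of_real p) * F f) =
     of_real (p * (1 - p)) *
       measure_pmf.expectation (bernoulli_product A p) (\<lambda>f. F (f(e := True)) - F (f(e := False)))"
proof -
  define B where "B = A - {e}"
  have B: "finite B" "e \<notin> B" "A = insert e B" using A unfolding B_def by auto
  note int = integrable_bernoulli_product[OF B(1)]
  show ?thesis unfolding B(3)
    by (subst (1 2) expectation_bernoulli_product_insert[OF B(1,2) p])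
       (simp add: int algebra_simps scaleR_conv_of_real)
qed

text \<open>Conditioning on one coin splits the variance into the average of the two conditional variances
  and \<open>p * (1 - p)\<close> times the squared difference of the two conditional means. The former are bounded
  by induction, and the latter is at most \<open>c\<^sup>2\<close>.\<close>

lemma efron_stein_bounded_differences:
  fixes F :: "('a \<Rightarrow> bool) \<Rightarrow> complex"
  assumes A: "finite A" and p: "0 \<le> p" "p \<le> 1"
    and bd: "\<And>e f. e \<in> A \<Longrightarrow> cmod (F (f(e := True)) - F (f(e := False))) \<le> c"
  shows "measure_pmf.expectation (bernoulli_product A p)
      (\<lambda>f. (cmod (F f - measure_pmf.expectation (bernoulli_product A p) F))\<^sup>2) \<le> real (card A) * c\<^sup>2"
proof -
  have "measure_pmf.expectation (bernoulli_product A p) (\<lambda>f. (cmod (F f))\<^sup>2)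
     - (cmod (measure_pmf.expectation (bernoulli_product A p) F))\<^sup>2 \<le> real (card A) * c\<^sup>2"
    using A bd
  proof (induction A arbitrary: F rule: finite_induct)
    case empty
    show ?case by simp
  next
    case (insert e A)
    define E1 where "E1 = measure_pmf.expectation (bernoulli_product A p) (\<lambda>f. F (f(e := True)))"
    define E0 where "E0 = measure_pmf.expectation (bernoulli_product A p) (\<lambda>f. F (f(e := False)))"
    define V1 where "V1 = measure_pmf.expectation (bernoulli_product A p) (\<lambda>f. (cmod (F (f(e := True))))\<^sup>2)"
    define V0 where "V0 = measure_pmf.expectation (bernoulli_product A p) (\<lambda>f. (cmod (F (f(e := False))))\<^sup>2)"
    have IH: "V1 - (cmod E1)\<^sup>2 \<le> real (card A) * c\<^sup>2" "V0 - (cmod E0)\<^sup>2 \<le> real (card A) * c\<^sup>2"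
      unfolding V1_def E1_def V0_def E0_def using insert.hyps
      by (intro insert.IH; metis fun_upd_twist insertCI insert.prems)+
    note int = integrable_bernoulli_product[OF insert.hyps(1)]
    have "cmod (E1 - E0) = cmod (measure_pmf.expectation (bernoulli_product A p)
        (\<lambda>f. F (f(e := True)) - F (f(e := False))))"
      unfolding E1_def E0_def by (simp add: int)
    also have "\<dots> \<le> measure_pmf.expectation (bernoulli_product A p)
        (\<lambda>f. cmod (F (f(e := True)) - F (f(e := False))))"
      by (rule integral_norm_bound)
    also have "\<dots> \<le> measure_pmf.expectation (bernoulli_product A p) (\<lambda>f. c)"
      by (intro integral_mono int insert.prems) auto
    finally have E10: "cmod (E1 - E0) \<le> c" by simp
    have "p * (1 - p) * (cmod (E1 - E0))\<^sup>2 \<le> 1 * c\<^sup>2"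
      using p E10 by (intro mult_mono power_mono) (auto intro: mult_le_one)
    moreover have "p * (V1 - (cmod E1)\<^sup>2) + (1 - p) * (V0 - (cmod E0)\<^sup>2) \<le>
        p * (real (card A) * c\<^sup>2) + (1 - p) * (real (card A) * c\<^sup>2)"
      using p IH by (intro add_mono mult_left_mono) auto
    moreover have "p * (cmod E1)\<^sup>2 + (1 - p) * (cmod E0)\<^sup>2 - (cmod (p *\<^sub>R E1 + (1 - p) *\<^sub>R E0))\<^sup>2
        = p * (1 - p) * (cmod (E1 - E0))\<^sup>2"
      unfolding cmod_power2 by (simp add: power2_eq_square algebra_simps)
    ultimately show ?case
      using insert.hyps
      by (simp add: expectation_bernoulli_product_insert[OF insert.hyps p] 
          E1_def[symmetric] E0_def[symmetric] V1_def[symmetric] V0_def[symmetric] algebra_simps)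
  qed
  moreover have "measure_pmf.expectation (bernoulli_product A p)
      (\<lambda>f. (cmod (F f - measure_pmf.expectation (bernoulli_product A p) F))\<^sup>2) =
      measure_pmf.expectation (bernoulli_product A p) (\<lambda>f. (cmod (F f))\<^sup>2)
     - (cmod (measure_pmf.expectation (bernoulli_product A p) F))\<^sup>2"
  proof -
    note int = integrable_bernoulli_product[OF A]
    define m where "m = measure_pmf.expectation (bernoulli_product A p) F"
    have "(\<lambda>f. (cmod (F f - m))\<^sup>2) = (\<lambda>f. (cmod (F f))\<^sup>2 + (cmod m)\<^sup>2 - 2 * Re (cnj m * F f))"
      unfolding cmod_power2 by (simp add: fun_eq_iff power2_eq_square algebra_simps)
    hence "measure_pmf.expectation (bernoulli_product A p) (\<lambda>f. (cmod (F f - m))\<^sup>2) =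
        measure_pmf.expectation (bernoulli_product A p) (\<lambda>f. (cmod (F f))\<^sup>2) + (cmod m)\<^sup>2
        - 2 * measure_pmf.expectation (bernoulli_product A p) (\<lambda>f. Re (cnj m * F f))"
      by (simp add: int)
    also have "measure_pmf.expectation (bernoulli_product A p) (\<lambda>f. Re (cnj m * F f)) = Re (cnj m * m)"
      unfolding m_def by (subst integral_Re) (simp_all add: int)
    also have "Re (cnj m * m) = (cmod m)\<^sup>2" unfolding cmod_power2 by (simp add: power2_eq_square)
    finally show ?thesis unfolding m_def by simp
  qed
  ultimately show ?thesis by simp
qed

section \<open>The centered adjacency matrix of a random graph\<close>

lemma finite_all_edges: "finite (all_edges n)"
  unfolding all_edges_def by (rule finite_subset[of _ "Pow {1..n}"]) auto

lemma card_all_edges_le: "card (all_edges n) \<le> n\<^sup>2"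
proof -
  have "card (all_edges n) = n choose 2"
    unfolding all_edges_def using n_subsets[of "{1..n}" 2] by simp
  thus ?thesis using binomial_le_pow2[of n 2] by (cases "n \<ge> 2") (auto simp: binomial_le_pow binomial_eq_0)
qed

lemma edge_in_all_edges: "i < n \<Longrightarrow> j < n \<Longrightarrow> i \<noteq> j \<Longrightarrow> {Suc i, Suc j} \<in> all_edges n"
  unfolding all_edges_def by auto

lemma all_edges_cases:
  assumes "e \<in> all_edges n"
  obtains a b where "a < n" "b < n" "a \<noteq> b" "e = {Suc a, Suc b}"
proof -
  obtain x y where xy: "e = {x, y}" "x \<noteq> y" using assms unfolding all_edges_def by (auto simp: card_2_iff)
  hence "x \<in> {1..n}" "y \<in> {1..n}" using assms unfolding all_edges_def by auto
  thus ?thesis using xy by (intro that[of "x - 1" "y - 1"]) auto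
qed

text \<open>The Wigner matrix of the graph whose edges are the \<open>e\<close> with \<open>f e\<close>. The scaling by \<open>1 / sqrt n\<close>
  keeps the eigenvalues of bounded order.\<close>

definition centered_adjacency :: "nat \<Rightarrow> real \<Rightarrow> (nat set \<Rightarrow> bool) \<Rightarrow> nat \<Rightarrow> nat \<Rightarrow> real" where
  "centered_adjacency n p f i j = (if i = j then 0 else (of_bool (f {Suc i, Suc j}) - p) / sqrt n)"

lemma centered_adjacency_sym: "centered_adjacency n p f i j = centered_adjacency n p f j i"
  unfolding centered_adjacency_def by (simp add: insert_commute)

text \<open>Graphs that differ in at most one edge have matrices that differ as required by the
  two-entry perturbation lemmas.\<close>

lemma centered_adjacency_diff:
  assumes "a \<noteq> b" "\<And>e. e \<noteq> {Suc a, Suc b} \<Longrightarrow> f e = g e"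
  shows "centered_adjacency n p f i j - centered_adjacency n p g i j =
    (of_bool (f {Suc a, Suc b}) - of_bool (g {Suc a, Suc b})) / sqrt n *
      (of_bool (i = a \<and> j = b) + of_bool (i = b \<and> j = a))"
proof (cases "{Suc i, Suc j} = {Suc a, Suc b}")
  case True
  hence "(i = a \<and> j = b) \<or> (i = b \<and> j = a)" by (auto simp: doubleton_eq_iff)
  thus ?thesis using assms(1)
    by (elim disjE) (auto simp: centered_adjacency_def diff_divide_distrib insert_commute)
next
  case False
  hence "\<not> (i = a \<and> j = b)" "\<not> (i = b \<and> j = a)" by (auto simp: doubleton_eq_iff)
  thus ?thesis using assms(2)[OF False] by (auto simp: centered_adjacency_def)
qed

abbreviation edge_pmf :: "nat \<Rightarrow> real \<Rightarrow> (nat set \<Rightarrow> bool) pmf" where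
  "edge_pmf n p \<equiv> bernoulli_product (all_edges n) p"

abbreviation mean :: "nat \<Rightarrow> real \<Rightarrow> ((nat set \<Rightarrow> bool) \<Rightarrow> 'b :: {banach, second_countable_topology}) \<Rightarrow> 'b" where
  "mean n p F \<equiv> measure_pmf.expectation (edge_pmf n p) F"

lemma integrable_edge_pmf:
  "integrable (measure_pmf (edge_pmf n p)) (F :: _ \<Rightarrow> 'b :: {banach, second_countable_topology})"
  by (rule integrable_bernoulli_product[OF finite_all_edges])

context
  fixes n :: nat and p t :: real
  assumes n: "n > 0" and p: "0 \<le> p" "p \<le> 1" and t: "t > 0"
begin

abbreviation "res f \<equiv> resolvent n (centered_adjacency n p f) t"
text \<open>\<open>nrt\<close> stands for normalized resolvent trace.\<close>

abbreviation "nrt f \<equiv> stieltjes n (centered_adjacency n p f) t"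

lemma res_is_resolvent: "is_resolvent n (centered_adjacency n p f) (\<i> * of_real t) (res f)"
  by (rule resolvent_is_resolvent[OF centered_adjacency_sym t])

lemma res_entry_le: "i < n \<Longrightarrow> j < n \<Longrightarrow> cmod (res f i j) \<le> 1 / t"
  by (rule resolvent_entry_le[OF centered_adjacency_sym res_is_resolvent t])

lemma res_edge_entry_change:
  assumes ab: "a < n" "b < n" "a \<noteq> b" and ij: "i < n" "j < n"
  shows "cmod (res (f({Suc a, Suc b} := v)) i j - res f i j) \<le> 2 / (sqrt n * t\<^sup>2)"
proof -
  let ?c = "(of_bool v - of_bool (f {Suc a, Suc b})) / sqrt n :: real"
  have "cmod (res (f({Suc a, Suc b} := v)) i j - res f i j) \<le> 2 * \<bar>?c\<bar> / t\<^sup>2"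
    by (rule resolvent_two_entry_perturbation_entry[OF centered_adjacency_sym centered_adjacency_sym t ab(1,2) _ ij])
       (subst centered_adjacency_diff[OF ab(3)]; simp)
  also have "\<dots> \<le> 2 * (1 / sqrt n) / t\<^sup>2"
    by (intro divide_right_mono mult_left_mono) (auto simp: abs_divide intro!: divide_right_mono)
  finally show ?thesis by simp
qed

lemma res_edge_discrete_derivative:
  assumes ab: "a < n" "b < n" "a \<noteq> b" and ij: "i < n" "j < n"
  shows "res (f({Suc a, Suc b} := True)) i j - res (f({Suc a, Suc b} := False)) i j =
    - of_real (1 / sqrt n) *
      (res (f({Suc a, Suc b} := True)) i a * res (f({Suc a, Suc b} := False)) b j +
       res (f({Suc a, Suc b} := True)) i b * res (f({Suc a, Suc b} := False)) a j)"
  by (rule resolvent_two_entry_perturbation[OF centered_adjacency_sym centered_adjacency_sym t ab(1,2) _ ij])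
     (subst centered_adjacency_diff[OF ab(3)]; simp)

lemma stieltjes_edge_change:
  assumes "e \<in> all_edges n"
  shows "cmod (nrt (f(e := True)) - nrt (f(e := False))) \<le> 2 / (n * sqrt n * t\<^sup>2)"
proof -
  obtain a b where ab: "a < n" "b < n" "a \<noteq> b" and e: "e = {Suc a, Suc b}"
    using assms by (rule all_edges_cases)
  have "cmod (nrt (f(e := True)) - nrt (f(e := False))) \<le> 2 * \<bar>1 / sqrt n\<bar> / (n * t\<^sup>2)"
    unfolding e
    by (rule stieltjes_two_entry_perturbation[OF centered_adjacency_sym centered_adjacency_sym t ab(1,2)])
       (subst centered_adjacency_diff[OF ab(3)]; simp)
  thus ?thesis by (simp add: mult_ac)
qed

text \<open>Each of the at most \<open>n\<^sup>2\<close> coins changes the trace by \<open>O(n powr (-3/2))\<close>.\<close>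

lemma stieltjes_variance: "mean n p (\<lambda>f. (cmod (nrt f - mean n p nrt))\<^sup>2) \<le> 4 / (n * t ^ 4)"
proof -
  have "mean n p (\<lambda>f. (cmod (nrt f - mean n p nrt))\<^sup>2) \<le> real (card (all_edges n)) * (2 / (n * sqrt n * t\<^sup>2))\<^sup>2"
    by (rule efron_stein_bounded_differences[OF finite_all_edges p stieltjes_edge_change])
  also have "\<dots> \<le> real (n\<^sup>2) * (2 / (n * sqrt n * t\<^sup>2))\<^sup>2"
    using card_all_edges_le[of n] by (intro mult_right_mono) (simp_all flip: of_nat_power)
  also have "\<dots> = 4 / (n * t ^ 4)"
    using n t by (simp add: power_divide power_mult_distrib field_simps eval_nat_numeral)
  finally show ?thesis .
qed

lemma stieltjes_mean_deviation: "mean n p (\<lambda>f. cmod (nrt f - mean n p nrt)) \<le> 2 / (sqrt n * t\<^sup>2)"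
proof -
  (* c is the bound on the standard deviation; x <= (x^2 / c + c) / 2 turns the bound on the
     second moment into one on the first. *)
  define c where "c = 2 / (sqrt n * t\<^sup>2)"
  have c: "c > 0" and c2: "c\<^sup>2 = 4 / (n * t ^ 4)" unfolding c_def using n t
    by (auto simp: power_divide power_mult_distrib)
  have "mean n p (\<lambda>f. cmod (nrt f - mean n p nrt)) \<le> mean n p (\<lambda>f. ((cmod (nrt f - mean n p nrt))\<^sup>2 / c + c) / 2)"
  proof (rule integral_mono[OF integrable_edge_pmf integrable_edge_pmf])
    fix f
    have "0 \<le> (cmod (nrt f - mean n p nrt) - c)\<^sup>2 / c" using c by simp
    thus "cmod (nrt f - mean n p nrt) \<le> ((cmod (nrt f - mean n p nrt))\<^sup>2 / c + c) / 2"
      using c by (simp add: power2_diff field_simps power2_eq_square)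
  qed
  also have "\<dots> = (mean n p (\<lambda>f. (cmod (nrt f - mean n p nrt))\<^sup>2) / c + c) / 2"
    by (simp add: integrable_edge_pmf)
  also have "\<dots> \<le> (c\<^sup>2 / c + c) / 2"
    using stieltjes_variance c unfolding c2 by (intro divide_right_mono add_right_mono) auto
  also have "\<dots> = c" using c by (simp add: power2_eq_square)
  finally show ?thesis unfolding c_def .
qed

text \<open>The normalized trace of the equation \<open>X R = I + i t R\<close>.\<close>

lemma one_plus_z_stieltjes:
  "1 + \<i> * of_real t * nrt f =
     (\<Sum>a<n. \<Sum>b<n. of_real (centered_adjacency n p f a b) * res f b a) / of_nat n"
proof -
  have "(\<Sum>b<n. of_real (centered_adjacency n p f a b) * res f b a) = 1 + \<i> * of_real t * res f a a"
    if a: "a < n" for a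
  proof -
    have "1 = (\<Sum>b<n. (of_real (centered_adjacency n p f a b) - \<i> * of_real t * of_bool (a = b)) * res f b a)"
      using res_is_resolvent[of f] a unfolding is_resolvent_def by simp
    also have "\<dots> = (\<Sum>b<n. of_real (centered_adjacency n p f a b) * res f b a)
        - \<i> * of_real t * (\<Sum>b<n. of_bool (a = b) * res f b a)"
      by (simp only: left_diff_distrib sum_subtractf sum_distrib_left mult.assoc)
    also have "(\<Sum>b<n. of_bool (a = b) * res f b a) = res f a a"
      by (rule sum_mult_of_bool_eq(4)[OF a])
    finally show ?thesis by (simp add: algebra_simps)
  qed
  hence "(\<Sum>a<n. \<Sum>b<n. of_real (centered_adjacency n p f a b) * res f b a) =
     of_nat n + \<i> * of_real t * (\<Sum>a<n. res f a a)"
    by (simp add: sum.distrib sum_distrib_left)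
  thus ?thesis using n by (simp add: stieltjes_def add_divide_distrib)
qed

text \<open>Integration by parts in the coin of the edge between \<open>a\<close> and \<open>b\<close> produces products of entries
  of the two resolvents in which that coin is fixed. Replacing both by the resolvent of the random
  graph itself costs \<open>O(1 / sqrt n)\<close> per product. On the diagonal the matrix vanishes, and the
  compensating term is bounded trivially.\<close>

lemma centered_adjacency_by_parts:
  assumes ab: "a < n" "b < n"
  shows "cmod (mean n p (\<lambda>f. of_real (centered_adjacency n p f a b) * res f b a) +
      of_real (p * (1 - p) / n) * mean n p (\<lambda>f. (res f b a)\<^sup>2 + res f b b * res f a a))
    \<le> 1 / n * (8 / (sqrt n * t ^ 3) + 2 / t\<^sup>2 * of_bool (b = a))"
proof -
  have pq: "0 \<le> p * (1 - p)" "p * (1 - p) \<le> 1" using p by (auto intro: mult_le_one)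
  have norm_pq: "cmod (of_real (p * (1 - p) / n)) = p * (1 - p) / n"
    using pq by (simp only: norm_of_real) simp
  show ?thesis
  proof (cases "a = b")
    case True
    have "cmod (mean n p (\<lambda>f. (res f b a)\<^sup>2 + res f b b * res f a a)) \<le> mean n p (\<lambda>f. cmod ((res f b a)\<^sup>2 + res f b b * res f a a))"
      by (rule integral_norm_bound)
    also have "\<dots> \<le> mean n p (\<lambda>f. 1 / t * (1 / t) + 1 / t * (1 / t))"
    proof (rule integral_mono[OF integrable_edge_pmf integrable_edge_pmf])
      fix f
      show "cmod ((res f b a)\<^sup>2 + res f b b * res f a a) \<le> 1 / t * (1 / t) + 1 / t * (1 / t)"
        unfolding power2_eq_square
        by (intro norm_triangle_mono; unfold norm_mult; intro mult_mono res_entry_le) (use t ab in auto)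
    qed
    finally have "cmod (mean n p (\<lambda>f. (res f b a)\<^sup>2 + res f b b * res f a a)) \<le> 2 / t\<^sup>2"
      by (simp add: power2_eq_square)
    hence "p * (1 - p) / n * cmod (mean n p (\<lambda>f. (res f b a)\<^sup>2 + res f b b * res f a a)) \<le> 1 / n * (2 / t\<^sup>2)"
      using pq by (intro mult_mono divide_right_mono) auto
    also have "\<dots> \<le> 1 / n * (8 / (sqrt n * t ^ 3) + 2 / t\<^sup>2)"
      using t by (intro mult_left_mono) auto
    finally have "cmod (of_real (p * (1 - p) / n) * mean n p (\<lambda>f. (res f b a)\<^sup>2 + res f b b * res f a a))
        \<le> 1 / n * (8 / (sqrt n * t ^ 3) + 2 / t\<^sup>2)"
      by (simp only: norm_mult norm_pq)
    thus ?thesis using True by (simp add: centered_adjacency_def)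
  next
    case False
    let ?e = "{Suc a, Suc b}"
    let ?f1 = "\<lambda>f. f(?e := True)" and ?f0 = "\<lambda>f. f(?e := False)"
    (* the discrete derivative of the entry of the resolvent, up to the factor - 1 / sqrt n *)
    define Q where "Q f = res (?f1 f) b a * res (?f0 f) b a + res (?f1 f) b b * res (?f0 f) a a" for f
    have e: "?e \<in> all_edges n" using edge_in_all_edges ab False by blast
    have "mean n p (\<lambda>f. of_real (centered_adjacency n p f a b) * res f b a) =
        of_real (1 / sqrt n) * mean n p (\<lambda>f. (of_bool (f ?e) - of_real p) * res f b a)"
    proof -
      have "of_real (centered_adjacency n p f a b) = of_real (1 / sqrt n) * (of_bool (f ?e) - complex_of_real p)" for f
        using False by (cases "f ?e") (simp_all add: centered_adjacency_def)
      thus ?thesis by (simp only: mult.assoc integral_mult_right_zero)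
    qed
    also have "\<dots> = of_real (1 / sqrt n) * (of_real (p * (1 - p)) * mean n p (\<lambda>f. res (?f1 f) b a - res (?f0 f) b a))"
      by (subst bernoulli_integration_by_parts[OF finite_all_edges e p]) simp
    also have "(\<lambda>f. res (?f1 f) b a - res (?f0 f) b a) = (\<lambda>f. - of_real (1 / sqrt n) * Q f)"
      unfolding Q_def using ab False by (intro ext) (rule res_edge_discrete_derivative, auto)
    also have "of_real (1 / sqrt n) * (of_real (p * (1 - p)) * mean n p (\<lambda>f. - of_real (1 / sqrt n) * Q f)) =
       - of_real (p * (1 - p) / n) * mean n p Q"
    proof -
      have "mean n p (\<lambda>f. - of_real (1 / sqrt n) * Q f) = - of_real (1 / sqrt n) * mean n p Q"
        by (rule integral_mult_right_zero)
      moreover have "complex_of_real (1 / sqrt n) * of_real (1 / sqrt n) = of_real (1 / n)"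
        unfolding of_real_mult[symmetric] by simp
      ultimately show ?thesis by (simp add: divide_inverse mult_ac)
    qed
    finally have 1: "mean n p (\<lambda>f. of_real (centered_adjacency n p f a b) * res f b a) = - of_real (p * (1 - p) / n) * mean n p Q" .
    have "cmod (mean n p (\<lambda>f. (res f b a)\<^sup>2 + res f b b * res f a a) - mean n p Q) =
        cmod (mean n p (\<lambda>f. ((res f b a)\<^sup>2 + res f b b * res f a a) - Q f))"
      by (simp only: Bochner_Integration.integral_diff[OF integrable_edge_pmf integrable_edge_pmf])
    also have "\<dots> \<le> mean n p (\<lambda>f. cmod (((res f b a)\<^sup>2 + res f b b * res f a a) - Q f))"
      by (rule integral_norm_bound)
    also have "\<dots> \<le> mean n p (\<lambda>f. 8 / (sqrt n * t ^ 3))"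
    proof (rule integral_mono[OF integrable_edge_pmf integrable_edge_pmf])
      fix f
      have prod: "cmod (res f i j * res f k l - res (?f1 f) i j * res (?f0 f) k l) \<le> 4 / (sqrt n * t ^ 3)"
        if ijkl: "i < n" "j < n" "k < n" "l < n" for i j k l
      proof -
        have eq: "res f i j * res f k l - res (?f1 f) i j * res (?f0 f) k l =
           - (res (?f1 f) i j - res f i j) * res f k l - res (?f1 f) i j * (res (?f0 f) k l - res f k l)"
          by (simp add: algebra_simps)
        have "cmod (res f i j * res f k l - res (?f1 f) i j * res (?f0 f) k l) \<le>
            cmod (res (?f1 f) i j - res f i j) * cmod (res f k l) +
            cmod (res (?f1 f) i j) * cmod (res (?f0 f) k l - res f k l)"
          unfolding eq by (rule order_trans[OF norm_triangle_ineq4]) (simp only: norm_mult norm_minus_cancel)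
        also have "\<dots> \<le> 2 / (sqrt n * t\<^sup>2) * (1 / t) + 1 / t * (2 / (sqrt n * t\<^sup>2))"
          by (intro add_mono mult_mono res_entry_le res_edge_entry_change) (use t ab False ijkl in auto)
        also have "\<dots> = 4 / (sqrt n * t ^ 3)" using t n by (simp add: field_simps eval_nat_numeral)
        finally show ?thesis .
      qed
      have "cmod (((res f b a)\<^sup>2 + res f b b * res f a a) - Q f) =
         cmod ((res f b a * res f b a - res (?f1 f) b a * res (?f0 f) b a) +
              (res f b b * res f a a - res (?f1 f) b b * res (?f0 f) a a))"
        unfolding Q_def by (simp add: power2_eq_square algebra_simps)
      also have "\<dots> \<le> 4 / (sqrt n * t ^ 3) + 4 / (sqrt n * t ^ 3)"
        using ab by (intro norm_triangle_mono prod)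
      finally show "cmod (((res f b a)\<^sup>2 + res f b b * res f a a) - Q f) \<le> 8 / (sqrt n * t ^ 3)"
        by simp
    qed
    finally have 2: "cmod (mean n p (\<lambda>f. (res f b a)\<^sup>2 + res f b b * res f a a) - mean n p Q) \<le> 8 / (sqrt n * t ^ 3)"
      by simp
    have "cmod (mean n p (\<lambda>f. of_real (centered_adjacency n p f a b) * res f b a) +
        of_real (p * (1 - p) / n) * mean n p (\<lambda>f. (res f b a)\<^sup>2 + res f b b * res f a a)) =
        cmod (of_real (p * (1 - p) / n) * (mean n p (\<lambda>f. (res f b a)\<^sup>2 + res f b b * res f a a) - mean n p Q))"
      unfolding 1 by (simp only: right_diff_distrib) simp
    also have "\<dots> = p * (1 - p) / n * cmod (mean n p (\<lambda>f. (res f b a)\<^sup>2 + res f b b * res f a a) - mean n p Q)"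
      by (simp only: norm_mult norm_pq)
    also have "\<dots> \<le> 1 / n * (8 / (sqrt n * t ^ 3))"
      using pq 2 by (intro mult_mono divide_right_mono) auto
    finally show ?thesis using False by simp
  qed
qed

text \<open>Summing \<open>centered_adjacency_by_parts\<close> over all \<open>a\<close> and \<open>b\<close>: the products of diagonal entries add
  up to \<open>n\<^sup>2\<close> times the squared normalized trace, and the squares of entries contribute only \<open>O(n)\<close>
  because the columns of a resolvent have bounded norm.\<close>

lemma stieltjes_approximate_quadratic_equation:
  "cmod (1 + \<i> * of_real t * mean n p nrt + of_real (p * (1 - p)) * mean n p (\<lambda>f. (nrt f)\<^sup>2))
     \<le> 8 / (sqrt n * t ^ 3) + 3 / (n * t\<^sup>2)"
proof -
  let ?s2 = "p * (1 - p)"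
  have pq: "0 \<le> ?s2" "?s2 \<le> 1" using p by (auto intro: mult_le_one)
  define T where "T a b = mean n p (\<lambda>f. of_real (centered_adjacency n p f a b) * res f b a)" for a b
  define U where "U a b = mean n p (\<lambda>f. (res f b a)\<^sup>2 + res f b b * res f a a)" for a b
  have 1: "1 + \<i> * of_real t * mean n p nrt = (\<Sum>a<n. \<Sum>b<n. T a b) / of_nat n"
  proof -
    have "1 + \<i> * of_real t * mean n p nrt = mean n p (\<lambda>f. 1 + \<i> * of_real t * nrt f)"
      by (simp add: integrable_edge_pmf)
    also have "\<dots> = (\<Sum>a<n. \<Sum>b<n. T a b) / of_nat n"
      unfolding one_plus_z_stieltjes T_def by (simp add: integrable_edge_pmf)
    finally show ?thesis .
  qed
  have "cmod (\<Sum>a<n. \<Sum>b<n. T a b + of_real (?s2 / n) * U a b) \<le>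
      (\<Sum>a<n. \<Sum>b<n. 1 / n * (8 / (sqrt n * t ^ 3) + 2 / t\<^sup>2 * of_bool (b = a)))"
    unfolding T_def U_def
    by (intro order_trans[OF norm_sum] sum_mono order_trans[OF norm_sum] sum_mono centered_adjacency_by_parts) auto
  also have "\<dots> = (\<Sum>a<n. 1 / n * (n * (8 / (sqrt n * t ^ 3)) + 2 / t\<^sup>2))"
    by (intro sum.cong refl)
       (simp only: sum_distrib_left[symmetric] sum.distrib lessThan_iff sum_mult_of_bool_eq
          sum_constant card_lessThan, simp add: of_bool_def)
  also have "\<dots> = n * (8 / (sqrt n * t ^ 3)) + 2 / t\<^sup>2"
    using n by simp
  finally have 2: "cmod (\<Sum>a<n. \<Sum>b<n. T a b + of_real (?s2 / n) * U a b) \<le> n * (8 / (sqrt n * t ^ 3)) + 2 / t\<^sup>2" .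
  define V where "V = mean n p (\<lambda>f. \<Sum>a<n. \<Sum>b<n. (res f b a)\<^sup>2)"
  have U: "(\<Sum>a<n. \<Sum>b<n. U a b) = V + (of_nat n)\<^sup>2 * mean n p (\<lambda>f. (nrt f)\<^sup>2)"
  proof -
    have "(\<Sum>a<n. \<Sum>b<n. U a b) = mean n p (\<lambda>f. \<Sum>a<n. \<Sum>b<n. (res f b a)\<^sup>2 + res f b b * res f a a)"
      unfolding U_def by (simp only: Bochner_Integration.integral_sum integrable_edge_pmf)
    also have "(\<lambda>f. \<Sum>a<n. \<Sum>b<n. (res f b a)\<^sup>2 + res f b b * res f a a) =
        (\<lambda>f. (\<Sum>a<n. \<Sum>b<n. (res f b a)\<^sup>2) + (of_nat n)\<^sup>2 * (nrt f)\<^sup>2)"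
      using n by (simp add: sum.distrib stieltjes_def power2_eq_square sum_product mult.commute)
    also have "mean n p \<dots> = V + (of_nat n)\<^sup>2 * mean n p (\<lambda>f. (nrt f)\<^sup>2)"
      unfolding V_def by (simp add: integrable_edge_pmf)
    finally show ?thesis .
  qed
  have V: "cmod V \<le> n / t\<^sup>2"
  proof -
    have "cmod V \<le> mean n p (\<lambda>f. cmod (\<Sum>a<n. \<Sum>b<n. (res f b a)\<^sup>2))"
      unfolding V_def by (rule integral_norm_bound)
    also have "\<dots> \<le> mean n p (\<lambda>f. \<Sum>a<n. 1 / t\<^sup>2)"
    proof (rule integral_mono[OF integrable_edge_pmf integrable_edge_pmf])
      fix f
      have "cmod (\<Sum>a<n. \<Sum>b<n. (res f b a)\<^sup>2) \<le> (\<Sum>a<n. \<Sum>b<n. (cmod (res f b a))\<^sup>2)"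
        by (intro order_trans[OF norm_sum] sum_mono) (auto simp: norm_power)
      also have "\<dots> \<le> (\<Sum>a<n. 1 / t\<^sup>2)"
        by (intro sum_mono resolvent_column_norm_le[OF centered_adjacency_sym res_is_resolvent t]) auto
      finally show "cmod (\<Sum>a<n. \<Sum>b<n. (res f b a)\<^sup>2) \<le> (\<Sum>a<n. 1 / t\<^sup>2)" .
    qed
    finally show ?thesis by simp
  qed
  have "1 + \<i> * of_real t * mean n p nrt + of_real ?s2 * mean n p (\<lambda>f. (nrt f)\<^sup>2) =
     ((\<Sum>a<n. \<Sum>b<n. T a b + of_real (?s2 / n) * U a b) - of_real (?s2 / n) * V) / of_nat n"
  proof -
    define A where "A = (\<Sum>a<n. \<Sum>b<n. T a b + of_real (?s2 / n) * U a b)"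
    define B where "B = (\<Sum>a<n. \<Sum>b<n. T a b)"
    define q where "q = complex_of_real ?s2"
    have q: "of_real (?s2 / n) = q / of_nat n" unfolding q_def by simp
    have A: "A = B + of_real (?s2 / n) * (V + (of_nat n)\<^sup>2 * mean n p (\<lambda>f. (nrt f)\<^sup>2))"
      unfolding A_def B_def U[symmetric] by (simp only: sum.distrib sum_distrib_left)
    show ?thesis unfolding 1 A_def[symmetric] B_def[symmetric] unfolding A q q_def[symmetric] using n
      by (simp add: field_simps power2_eq_square)
  qed
  hence "cmod (1 + \<i> * of_real t * mean n p nrt + of_real ?s2 * mean n p (\<lambda>f. (nrt f)\<^sup>2)) =
     cmod ((\<Sum>a<n. \<Sum>b<n. T a b + of_real (?s2 / n) * U a b) - of_real (?s2 / n) * V) / n"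
    by (simp add: norm_divide)
  also have "\<dots> \<le> (n * (8 / (sqrt n * t ^ 3)) + 2 / t\<^sup>2 + 1 / n * (n / t\<^sup>2)) / n"
  proof (intro divide_right_mono order_trans[OF norm_triangle_ineq4] add_mono 2)
    show "cmod (of_real (?s2 / n) * V) \<le> 1 / n * (n / t\<^sup>2)"
      unfolding norm_mult norm_of_real using pq V by (intro mult_mono) (auto simp: divide_right_mono abs_mult)
  qed simp
  also have "\<dots> = 8 / (sqrt n * t ^ 3) + 3 / (n * t\<^sup>2)"
    using n t by (simp add: field_simps)
  finally show ?thesis .
qed

end

section \<open>The semicircle equation\<close>

text \<open>The Stieltjes transform of the semicircle law of variance \<open>v\<close> at \<open>i t\<close> is \<open>i\<close> times this
  number.\<close>

definition semicircle_height :: "real \<Rightarrow> real \<Rightarrow> real" where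
  "semicircle_height v t = (sqrt (t\<^sup>2 + 4 * v) - t) / (2 * v)"

lemma semicircle_height_equation:
  assumes v: "v > 0"
  shows "v * (semicircle_height v t)\<^sup>2 + t * semicircle_height v t = 1"
proof -
  define r where "r = sqrt (t\<^sup>2 + 4 * v)"
  have r: "r * r = t * t + 4 * v" unfolding r_def using v by (simp add: power2_eq_square add_nonneg_pos less_imp_le)
  have y: "semicircle_height v t = (r - t) / (2 * v)" unfolding semicircle_height_def r_def ..
  show ?thesis unfolding y using v r
    by (simp add: field_simps power2_eq_square)
qed

lemma semicircle_height_pos:
  assumes v: "v > 0"
  shows "semicircle_height v t > 0"
proof -
  have "\<bar>t\<bar> < sqrt (t\<^sup>2 + 4 * v)" using v by (intro real_less_rsqrt) simp
  thus ?thesis unfolding semicircle_height_def using v by (intro divide_pos_pos) auto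
qed

text \<open>The quadratic polynomial has the roots \<open>i y\<close> and \<open>i y'\<close> with \<open>y' < 0 < y\<close>. A point of the closed
  upper half plane has distance at least \<open>t / v\<close> from the second root, so a small value of the
  polynomial forces it to be near the first one.\<close>

lemma semicircle_quadratic_stability:
  assumes v: "v > 0" and t: "t > 0" and m: "Im m \<ge> 0"
  shows "t * cmod (m - \<i> * of_real (semicircle_height v t)) \<le>
    cmod (1 + \<i> * of_real t * m + of_real v * m\<^sup>2)"
proof -
  define y where "y = semicircle_height v t"
  (* the other root, from the sum of the roots *)
  define y' where "y' = - t / v - y"
  have y: "v * y\<^sup>2 + t * y = 1" "y > 0"
    unfolding y_def by (rule semicircle_height_equation[OF v] semicircle_height_pos[OF v])+
  have s: "v * (y + y') = - t" using v unfolding y'_def by simp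
  have "v * (y * y') = - (v * y\<^sup>2 + t * y)"
    using v unfolding y'_def by (simp add: field_simps power2_eq_square)
  hence pr: "v * (y * y') = - 1" using y(1) by simp
  have "1 + \<i> * of_real t * m + of_real v * m\<^sup>2 =
      of_real v * m\<^sup>2 - \<i> * of_real (v * (y + y')) * m - of_real (v * (y * y'))"
    unfolding s pr by simp
  also have "\<dots> = of_real v * (m - \<i> * of_real y) * (m - \<i> * of_real y')"
    by (simp add: algebra_simps power2_eq_square)
  finally have fac: "1 + \<i> * of_real t * m + of_real v * m\<^sup>2 = of_real v * (m - \<i> * of_real y) * (m - \<i> * of_real y')" .
  have "t / v \<le> Im (m - \<i> * of_real y')" using m y(2) unfolding y'_def by simp
  also have "\<dots> \<le> cmod (m - \<i> * of_real y')" by (rule order_trans[OF abs_ge_self abs_Im_le_cmod])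
  finally have "t \<le> v * cmod (m - \<i> * of_real y')" using v by (simp add: field_simps)
  hence "t * cmod (m - \<i> * of_real y) \<le> v * cmod (m - \<i> * of_real y') * cmod (m - \<i> * of_real y)"
    by (intro mult_right_mono) auto
  thus ?thesis unfolding fac y_def[symmetric] using v by (simp add: norm_mult mult_ac)
qed

text \<open>Three errors add up: the fluctuation of the trace, the variance incurred when the mean of the
  square is replaced by the square of the mean, and the error of the quadratic equation.\<close>

lemma stieltjes_mean_error:
  assumes n: "n > 0" and p: "0 < p" "p < 1" and t: "t > 0"
  shows "mean n p
      (\<lambda>f. cmod (stieltjes n (centered_adjacency n p f) t - \<i> * of_real (semicircle_height (p * (1 - p)) t)))
    \<le> 2 / (sqrt n * t\<^sup>2) + (8 / (sqrt n * t ^ 3) + 3 / (n * t\<^sup>2) + 4 / (n * t ^ 4)) / t"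
proof -
  let ?v = "p * (1 - p)"
  have v: "0 < ?v" "?v \<le> 1" using p by (auto intro: mult_le_one)
  have p': "0 \<le> p" "p \<le> 1" using p by auto
  define s where "s f = stieltjes n (centered_adjacency n p f) t" for f
  define m where "m = mean n p s"
  define y where "y = semicircle_height ?v t"
  note int = integrable_edge_pmf[of n p]
  have var: "mean n p (\<lambda>f. (cmod (s f - m))\<^sup>2) \<le> 4 / (n * t ^ 4)"
    using stieltjes_variance[OF n p' t] unfolding s_def m_def by simp
  have dev: "mean n p (\<lambda>f. cmod (s f - m)) \<le> 2 / (sqrt n * t\<^sup>2)"
    using stieltjes_mean_deviation[OF n p' t] unfolding s_def m_def by simp
  have quad: "cmod (1 + \<i> * of_real t * m + of_real ?v * mean n p (\<lambda>f. (s f)\<^sup>2))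
     \<le> 8 / (sqrt n * t ^ 3) + 3 / (n * t\<^sup>2)"
    using stieltjes_approximate_quadratic_equation[OF n p' t] unfolding s_def m_def by simp
  have Em2: "mean n p (\<lambda>f. (s f - m)\<^sup>2) = mean n p (\<lambda>f. (s f)\<^sup>2) - m\<^sup>2"
  proof -
    have "mean n p (\<lambda>f. (s f - m)\<^sup>2) = mean n p (\<lambda>f. (s f)\<^sup>2 - 2 * m * s f + m\<^sup>2)"
      by (simp add: power2_diff algebra_simps)
    also have "\<dots> = mean n p (\<lambda>f. (s f)\<^sup>2) - 2 * m * m + m\<^sup>2" by (simp add: int m_def[symmetric])
    finally show ?thesis by (simp add: power2_eq_square)
  qed
  have sq: "cmod (mean n p (\<lambda>f. (s f)\<^sup>2) - m\<^sup>2) \<le> 4 / (n * t ^ 4)"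
  proof -
    have "cmod (mean n p (\<lambda>f. (s f - m)\<^sup>2)) \<le> mean n p (\<lambda>f. cmod ((s f - m)\<^sup>2))" by (rule integral_norm_bound)
    thus ?thesis using var unfolding Em2 norm_power by simp
  qed
  have "Im m = mean n p (\<lambda>f. Im (s f))" unfolding m_def by (subst integral_Im) (auto simp: int)
  also have "\<dots> \<ge> 0"
    unfolding s_def by (intro integral_nonneg_AE AE_I2 Im_stieltjes_nonneg[OF centered_adjacency_sym t])
  finally have Im: "Im m \<ge> 0" .
  have "t * cmod (m - \<i> * of_real y) \<le> cmod (1 + \<i> * of_real t * m + of_real ?v * m\<^sup>2)"
    unfolding y_def by (rule semicircle_quadratic_stability[OF v(1) t Im])
  also have "\<dots> = cmod ((1 + \<i> * of_real t * m + of_real ?v * mean n p (\<lambda>f. (s f)\<^sup>2)) - of_real ?v * (mean n p (\<lambda>f. (s f)\<^sup>2) - m\<^sup>2))"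
    by (rule arg_cong[of _ _ cmod]) (simp add: algebra_simps)
  also have "\<dots> \<le> (8 / (sqrt n * t ^ 3) + 3 / (n * t\<^sup>2)) + 1 * (4 / (n * t ^ 4))"
  proof (rule order_trans[OF norm_triangle_ineq4 add_mono[OF quad]])
    have "cmod (of_real ?v) \<le> 1" using v by (simp only: norm_of_real)
    thus "cmod (of_real ?v * (mean n p (\<lambda>f. (s f)\<^sup>2) - m\<^sup>2)) \<le> 1 * (4 / (n * t ^ 4))"
      unfolding norm_mult by (intro mult_mono sq) auto
  qed
  finally have bias: "cmod (m - \<i> * of_real y) \<le> (8 / (sqrt n * t ^ 3) + 3 / (n * t\<^sup>2) + 4 / (n * t ^ 4)) / t"
    using t by (simp add: pos_le_divide_eq mult.commute)
  have "mean n p (\<lambda>f. cmod (s f - \<i> * of_real y)) \<le> mean n p (\<lambda>f. cmod (s f - m) + cmod (m - \<i> * of_real y))"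
    by (intro integral_mono int) (use norm_triangle_ineq[of "s _ - m" "m - \<i> * of_real y"] in simp)
  also have "\<dots> = mean n p (\<lambda>f. cmod (s f - m)) + cmod (m - \<i> * of_real y)" by (simp add: int)
  finally show ?thesis using dev bias unfolding s_def y_def by simp
qed

section \<open>From the harmonic matrix to the centered adjacency matrix\<close>

text \<open>A constant matrix and a matrix of small Frobenius norm hardly move the normalized trace of the
  resolvent. The constant part contributes \<open>c\<close> times the scalar product of the images of the all-ones
  vector under both resolvents, which is at most \<open>n / t\<^sup>2\<close>; the other part is estimated by the
  Cauchy-Schwarz inequality.\<close>

lemma stieltjes_perturbation:
  assumes n: "n > 0" and t: "t > 0"
    and sym1: "\<And>i j. i < n \<Longrightarrow> j < n \<Longrightarrow> M1 i j = M1 j i"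
    and sym0: "\<And>i j. i < n \<Longrightarrow> j < n \<Longrightarrow> M0 i j = M0 j i"
    and diff: "\<And>i j. i < n \<Longrightarrow> j < n \<Longrightarrow> M1 i j - M0 i j = c + D i j"
  shows "cmod (stieltjes n M1 t - stieltjes n M0 t) \<le>
    (sqrt ((\<Sum>i<n. \<Sum>j<n. (D i j)\<^sup>2) / n) + \<bar>c\<bar>) / t\<^sup>2"
proof -
  let ?R1 = "resolvent n M1 t" and ?R0 = "resolvent n M0 t"
  define S where "S = (\<Sum>i<n. \<Sum>j<n. (D i j)\<^sup>2)"
  have R1: "is_resolvent n M1 (\<i> * of_real t) ?R1" by (rule resolvent_is_resolvent[OF sym1 t])
  have R0: "is_resolvent n M0 (\<i> * of_real t) ?R0" by (rule resolvent_is_resolvent[OF sym0 t])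
  have col1: "(\<Sum>i<n. (cmod (?R1 i j))\<^sup>2) \<le> 1 / t\<^sup>2" if "j < n" for j
    by (rule resolvent_column_norm_le[OF sym1 R1 t that])
  define Q where "Q k l = (\<Sum>i<n. ?R0 l i * ?R1 i k)" for k l
  (* In the last double sum the factor Q is the product of the two resolvents in reverse order,
     by cyclicity of the trace. *)
  have main: "(\<Sum>i<n. ?R1 i i - ?R0 i i) =
     - of_real c * (\<Sum>i<n. (\<Sum>k<n. ?R1 i k) * (\<Sum>l<n. ?R0 l i)) - (\<Sum>k<n. \<Sum>l<n. of_real (D k l) * Q k l)"
  proof -
    have "(\<Sum>i<n. ?R1 i i - ?R0 i i) =
       (\<Sum>i<n. \<Sum>k<n. \<Sum>l<n. ?R1 i k * of_real (M0 k l - M1 k l) * ?R0 l i)"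
      by (intro sum.cong refl resolvent_identity[OF R1 R0]) auto
    also have "\<dots> = (\<Sum>i<n. \<Sum>k<n. \<Sum>l<n. - of_real c * (?R1 i k * ?R0 l i) - of_real (D k l) * (?R0 l i * ?R1 i k))"
    proof (intro sum.cong refl)
      fix i k l assume "k \<in> {..<n}" "l \<in> {..<n}"
      hence e: "M0 k l - M1 k l = - c - D k l" using diff[of k l] by simp
      show "?R1 i k * of_real (M0 k l - M1 k l) * ?R0 l i =
        - of_real c * (?R1 i k * ?R0 l i) - of_real (D k l) * (?R0 l i * ?R1 i k)"
        unfolding e by (simp add: algebra_simps)
    qed
    also have "\<dots> = - of_real c * (\<Sum>i<n. (\<Sum>k<n. ?R1 i k) * (\<Sum>l<n. ?R0 l i)) -
        (\<Sum>i<n. \<Sum>k<n. \<Sum>l<n. of_real (D k l) * (?R0 l i * ?R1 i k))"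
      unfolding sum_product by (simp only: sum_subtractf sum_distrib_left)
    also have "(\<Sum>i<n. \<Sum>k<n. \<Sum>l<n. of_real (D k l) * (?R0 l i * ?R1 i k)) =
        (\<Sum>k<n. \<Sum>i<n. \<Sum>l<n. of_real (D k l) * (?R0 l i * ?R1 i k))"
      by (rule sum.swap)
    also have "\<dots> = (\<Sum>k<n. \<Sum>l<n. \<Sum>i<n. of_real (D k l) * (?R0 l i * ?R1 i k))"
      by (intro sum.cong refl sum.swap)
    also have "\<dots> = (\<Sum>k<n. \<Sum>l<n. of_real (D k l) * Q k l)"
      unfolding Q_def by (simp only: sum_distrib_left)
    finally show ?thesis .
  qed
  have c_part: "cmod (- of_real c * (\<Sum>i<n. (\<Sum>k<n. ?R1 i k) * (\<Sum>l<n. ?R0 l i))) \<le> \<bar>c\<bar> * (n / t\<^sup>2)"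
  proof -
    have 1: "(\<Sum>i<n. (cmod (\<Sum>k<n. ?R1 i k))\<^sup>2) \<le> n / t\<^sup>2"
      using resolvent_contraction[OF sym1 R1 t, of "\<lambda>_. 1"] by simp
    have "(\<Sum>i<n. (cmod (\<Sum>l<n. ?R0 i l))\<^sup>2) \<le> n / t\<^sup>2"
      using resolvent_contraction[OF sym0 R0 t, of "\<lambda>_. 1"] by simp
    also have "(\<Sum>i<n. (cmod (\<Sum>l<n. ?R0 i l))\<^sup>2) = (\<Sum>i<n. (cmod (\<Sum>l<n. ?R0 l i))\<^sup>2)"
    proof (intro sum.cong refl)
      fix i assume "i \<in> {..<n}"
      hence "(\<Sum>l<n. ?R0 i l) = (\<Sum>l<n. ?R0 l i)"
        by (intro sum.cong refl resolvent_sym[OF sym0 t]) auto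
      thus "(cmod (\<Sum>l<n. ?R0 i l))\<^sup>2 = (cmod (\<Sum>l<n. ?R0 l i))\<^sup>2" by simp
    qed
    finally have 2: "(\<Sum>i<n. (cmod (\<Sum>l<n. ?R0 l i))\<^sup>2) \<le> n / t\<^sup>2" .
    have "cmod (\<Sum>i<n. (\<Sum>k<n. ?R1 i k) * (\<Sum>l<n. ?R0 l i)) \<le> n / t\<^sup>2"
      by (rule order_trans[OF norm_sum sum_cmod_mult_le[OF 1 2]])
    thus ?thesis unfolding norm_mult by (intro mult_mono) auto
  qed
  have D_part: "cmod (\<Sum>k<n. \<Sum>l<n. of_real (D k l) * Q k l) \<le> sqrt S * (sqrt n / t\<^sup>2)"
  proof -
    have "(\<Sum>k<n. \<Sum>l<n. (cmod (Q k l))\<^sup>2) \<le> (\<Sum>k<n. 1 / t\<^sup>2 / t\<^sup>2)"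
    proof (intro sum_mono)
      fix k assume k: "k \<in> {..<n}"
      have "(\<Sum>l<n. (cmod (Q k l))\<^sup>2) \<le> (\<Sum>i<n. (cmod (?R1 i k))\<^sup>2) / t\<^sup>2"
        unfolding Q_def by (rule resolvent_contraction[OF sym0 R0 t])
      also have "\<dots> \<le> 1 / t\<^sup>2 / t\<^sup>2" using k by (intro divide_right_mono col1) auto
      finally show "(\<Sum>l<n. (cmod (Q k l))\<^sup>2) \<le> 1 / t\<^sup>2 / t\<^sup>2" .
    qed
    hence Q: "(\<Sum>k<n. \<Sum>l<n. (cmod (Q k l))\<^sup>2) \<le> n / (t\<^sup>2)\<^sup>2" by (simp add: power2_eq_square)
    have "cmod (\<Sum>k<n. \<Sum>l<n. of_real (D k l) * Q k l) \<le> (\<Sum>k<n. \<Sum>l<n. \<bar>D k l\<bar> * cmod (Q k l))"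
      by (intro order_trans[OF norm_sum] sum_mono) (auto simp: norm_mult intro!: sum_mono order_trans[OF norm_sum])
    also have "\<dots> = (\<Sum>x\<in>{..<n}\<times>{..<n}. \<bar>D (fst x) (snd x)\<bar> * cmod (Q (fst x) (snd x)))"
      by (simp add: sum.cartesian_product case_prod_beta)
    also have "\<dots> \<le> sqrt ((\<Sum>x\<in>{..<n}\<times>{..<n}. \<bar>D (fst x) (snd x)\<bar>\<^sup>2) * (\<Sum>x\<in>{..<n}\<times>{..<n}. (cmod (Q (fst x) (snd x)))\<^sup>2))"
      by (rule real_le_rsqrt, rule Cauchy_Schwarz_ineq_sum)
    also have "\<dots> = sqrt (S * (\<Sum>k<n. \<Sum>l<n. (cmod (Q k l))\<^sup>2))"
      unfolding S_def by (simp add: sum.cartesian_product case_prod_beta)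
    also have "\<dots> \<le> sqrt (S * (n / (t\<^sup>2)\<^sup>2))"
      using Q by (intro real_sqrt_le_mono mult_left_mono) (auto simp: S_def sum_nonneg)
    also have "\<dots> = sqrt S * (sqrt n / t\<^sup>2)"
      by (simp only: real_sqrt_mult real_sqrt_divide real_sqrt_abs) simp
    finally show ?thesis .
  qed
  have "cmod (stieltjes n M1 t - stieltjes n M0 t) = cmod (\<Sum>i<n. ?R1 i i - ?R0 i i) / n"
    unfolding stieltjes_def by (simp add: diff_divide_distrib[symmetric] sum_subtractf norm_divide)
  also have "\<dots> \<le> (\<bar>c\<bar> * (n / t\<^sup>2) + sqrt S * (sqrt n / t\<^sup>2)) / n"
    unfolding main
    by (intro divide_right_mono order_trans[OF norm_triangle_ineq4] add_mono c_part D_part) auto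
  also have "\<dots> = (sqrt S / sqrt n + \<bar>c\<bar>) / t\<^sup>2"
  proof -
    have "(\<bar>c\<bar> * (n / t\<^sup>2) + sqrt S * (sqrt n / t\<^sup>2)) / n = (sqrt S * (sqrt n / n) + \<bar>c\<bar>) / t\<^sup>2"
      using n t by (simp add: field_simps)
    also have "sqrt n / n = 1 / sqrt n" by (simp add: sqrt_divide_self_eq inverse_eq_divide)
    finally show ?thesis by simp
  qed
  finally show ?thesis unfolding S_def by (simp add: real_sqrt_divide)
qed

definition edges_of :: "nat \<Rightarrow> (nat set \<Rightarrow> bool) \<Rightarrow> nat set set" where
  "edges_of n f = {e \<in> all_edges n. f e}"

definition vertex_degree :: "nat \<Rightarrow> (nat set \<Rightarrow> bool) \<Rightarrow> nat \<Rightarrow> real" where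
  "vertex_degree n f i = real (graph_degree (edges_of n f) (Suc i))"

text \<open>The degree of a vertex is binomially distributed, as the number of successes among the \<open>n - 1\<close>
  coins of its incident pairs; Hoeffding's inequality applies.\<close>

lemma prob_degree_deviation:
  assumes i: "i < n" and n: "n > 1" and p: "0 \<le> p" "p \<le> 1" and \<epsilon>: "\<epsilon> \<ge> 0"
  shows "measure_pmf.prob (edge_pmf n p)
      {f. \<bar>vertex_degree n f i - real (n - 1) * p\<bar> \<ge> \<epsilon>} \<le> 2 * exp (- 2 * \<epsilon>\<^sup>2 / real (n - 1))"
proof -
  define A where "A = {e \<in> all_edges n. Suc i \<in> e}"
  have A: "finite A" "A \<subseteq> all_edges n" using finite_all_edges unfolding A_def by auto
  have "A = (\<lambda>j. {Suc i, j}) ` ({1..n} - {Suc i})"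
  proof (intro equalityI subsetI)
    fix e assume "e \<in> A"
    hence e: "e \<subseteq> {1..n}" "card e = 2" "Suc i \<in> e" unfolding A_def all_edges_def by auto
    then obtain j where "e = {Suc i, j}" "j \<noteq> Suc i" by (auto simp: card_2_iff)
    thus "e \<in> (\<lambda>j. {Suc i, j}) ` ({1..n} - {Suc i})" using e(1) by auto
  qed (use i in \<open>auto simp: A_def all_edges_def card_insert_if\<close>)
  moreover have "inj_on (\<lambda>j. {Suc i, j}) ({1..n} - {Suc i})"
    by (auto simp: inj_on_def doubleton_eq_iff)
  ultimately have card: "card A = n - 1" using i by (simp add: card_image)
  have deg: "vertex_degree n f i = card {e \<in> A. f e}" for f
    unfolding vertex_degree_def graph_degree_def edges_of_def A_def by (auto intro!: arg_cong[of _ _ card])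
  have "binomial_pmf (n - 1) p = map_pmf (\<lambda>f. card {e \<in> A. f e}) (bernoulli_product A p)"
    using binomial_pmf_altdef'[OF A(1) card, of p False] p by simp
  also have "\<dots> = map_pmf (\<lambda>f. card {e \<in> A. f e}) (edge_pmf n p)"
    unfolding Pi_pmf_subset[OF finite_all_edges A(2)] map_pmf_comp
    by (intro map_pmf_cong refl arg_cong[of _ _ card]) auto
  finally have bin: "binomial_pmf (n - 1) p = map_pmf (\<lambda>f. card {e \<in> A. f e}) (edge_pmf n p)" .
  have "measure_pmf.prob (edge_pmf n p)
      {f. \<bar>vertex_degree n f i - real (n - 1) * p\<bar> \<ge> \<epsilon>} =
      measure_pmf.prob (binomial_pmf (n - 1) p) {x. \<bar>real x - real (n - 1) * p\<bar> \<ge> \<epsilon>}"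
    unfolding bin measure_map_pmf deg by (simp add: vimage_def)
  also have "\<dots> \<le> 2 * exp (- 2 * \<epsilon>\<^sup>2 / real (n - 1))"
    by (rule binomial_distribution.prob_abs_ge) (use n p \<epsilon> in \<open>auto simp: binomial_distribution_def\<close>)
  finally show ?thesis .
qed

text \<open>The exponent \<open>3/4\<close> lies strictly between \<open>1/2\<close>, the order of the fluctuations of a degree, and
  \<open>1\<close>, the order of the degrees. The conditions on \<open>n\<close> are part of the event, so that estimates on it
  hold without restriction to large \<open>n\<close>.\<close>

definition near_regular :: "nat \<Rightarrow> real \<Rightarrow> (nat set \<Rightarrow> bool) \<Rightarrow> bool" where
  "near_regular n p f \<longleftrightarrow> n > 1 \<and> real n powr (3/4) + 1 \<le> n * p / 2 \<and>
     (\<forall>i<n. \<bar>vertex_degree n f i - real (n - 1) * p\<bar> < real n powr (3/4))"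

lemma prob_not_near_regular:
  assumes n: "n > 1" "real n powr (3/4) + 1 \<le> n * p / 2" and p: "0 \<le> p" "p \<le> 1"
  shows "measure_pmf.prob (edge_pmf n p) {f. \<not> near_regular n p f}
    \<le> n * (2 * exp (- 2 * sqrt n))"
proof -
  let ?P = "edge_pmf n p"
  have "{f. \<not> near_regular n p f} = (\<Union>i<n. {f. \<bar>vertex_degree n f i - real (n - 1) * p\<bar> \<ge> real n powr (3/4)})"
    using n unfolding near_regular_def by (auto simp: not_less)
  hence "measure_pmf.prob ?P {f. \<not> near_regular n p f} \<le>
    (\<Sum>i<n. measure_pmf.prob ?P {f. \<bar>vertex_degree n f i - real (n - 1) * p\<bar> \<ge> real n powr (3/4)})"
    by (simp add: measure_pmf.finite_measure_subadditive_finite)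
  also have "\<dots> \<le> (\<Sum>i<n. 2 * exp (- 2 * sqrt n))"
  proof (intro sum_mono)
    fix i assume "i \<in> {..<n}"
    hence "measure_pmf.prob ?P {f. \<bar>vertex_degree n f i - real (n - 1) * p\<bar> \<ge> real n powr (3/4)}
       \<le> 2 * exp (- 2 * (real n powr (3/4))\<^sup>2 / real (n - 1))"
      by (intro prob_degree_deviation n p) auto
    also have "(real n powr (3/4))\<^sup>2 = real n * sqrt n"
    proof -
      have "(real n powr (3/4))\<^sup>2 = real n powr (1 + 1/2)"
        unfolding power2_eq_square powr_add[symmetric] by simp
      thus ?thesis unfolding powr_add by (simp add: powr_half_sqrt)
    qed
    also have "- 2 * (real n * sqrt n) / real (n - 1) \<le> - 2 * sqrt n"
      using n(1) by (simp add: field_simps of_nat_diff)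
    finally show "measure_pmf.prob ?P {f. \<bar>vertex_degree n f i - real (n - 1) * p\<bar> \<ge> real n powr (3/4)}
       \<le> 2 * exp (- 2 * sqrt n)" by simp
  qed
  finally show ?thesis by simp
qed

text \<open>The scaling gives this matrix the same order as \<open>centered_adjacency\<close>.\<close>

definition scaled_harmonic :: "nat \<Rightarrow> real \<Rightarrow> (nat set \<Rightarrow> bool) \<Rightarrow> nat \<Rightarrow> nat \<Rightarrow> real" where
  "scaled_harmonic n p f i j = sqrt n * p * harmonic_matrix n (edges_of n f) $$ (i, j)"

lemma scaled_harmonic_entry:
  assumes "i < n" "j < n"
  shows "scaled_harmonic n p f i j =
    (if i \<noteq> j \<and> f {Suc i, Suc j} then 2 * sqrt n * p / (vertex_degree n f i + vertex_degree n f j) else 0)"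
proof -
  have "{Suc i, Suc j} \<in> edges_of n f \<longleftrightarrow> i \<noteq> j \<and> f {Suc i, Suc j}"
    using assms edge_in_all_edges[OF assms] by (cases "i = j") (auto simp: edges_of_def all_edges_def)
  thus ?thesis using assms unfolding scaled_harmonic_def harmonic_matrix_def vertex_degree_def by simp
qed

lemma scaled_harmonic_sym:
  assumes "i < n" "j < n"
  shows "scaled_harmonic n p f i j = scaled_harmonic n p f j i"
  using assms by (simp add: scaled_harmonic_entry insert_commute add.commute)

lemma near_regular_degree:
  assumes "near_regular n p f" "i < n" "p \<le> 1" "0 \<le> p"
  shows "\<bar>vertex_degree n f i - n * p\<bar> \<le> real n powr (3/4) + 1" "vertex_degree n f i \<ge> n * p / 2"
proof -
  have n: "n > 1" "real n powr (3/4) + 1 \<le> n * p / 2" "\<bar>vertex_degree n f i - real (n - 1) * p\<bar> < real n powr (3/4)"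
    using assms unfolding near_regular_def by auto
  have "real (n - 1) * p = n * p - p" using n(1) by (simp add: of_nat_diff algebra_simps)
  thus "\<bar>vertex_degree n f i - n * p\<bar> \<le> real n powr (3/4) + 1" using n(3) assms by linarith
  thus "vertex_degree n f i \<ge> n * p / 2" using n(2) by linarith
qed

text \<open>This bounds the second moment of the eigenvalue distribution by 4, which controls the decay in
  \<open>t\<close> needed for dominated convergence.\<close>

lemma scaled_harmonic_sum_squares:
  assumes nr: "near_regular n p f" and p: "0 < p" "p \<le> 1"
  shows "(\<Sum>i<n. \<Sum>j<n. (scaled_harmonic n p f i j)\<^sup>2) \<le> 4 * n"
proof -
  have n: "n > 1" using nr unfolding near_regular_def by auto
  have "(\<Sum>i<n. \<Sum>j<n. (scaled_harmonic n p f i j)\<^sup>2) \<le> (\<Sum>i<n. \<Sum>j<n. 4 / n)"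
  proof (intro sum_mono)
    fix i j assume "i \<in> {..<n}" "j \<in> {..<n}"
    hence ij: "i < n" "j < n" by auto
    have d: "vertex_degree n f i + vertex_degree n f j \<ge> n * p"
      using near_regular_degree(2)[OF nr ij(1)] near_regular_degree(2)[OF nr ij(2)] p by simp
    have np: "n * p > 0" using n p by simp
    have "2 * sqrt n * p / (vertex_degree n f i + vertex_degree n f j) \<le> 2 * sqrt n * p / (n * p)"
      by (rule divide_left_mono[OF d]) (use d np p in \<open>auto intro!: mult_pos_pos simp del: of_nat_0_less_iff zero_less_mult_iff\<close>)
    also have "\<dots> = 2 * (sqrt n / n)" using p by simp
    also have "\<dots> = 2 / sqrt n" by (simp add: sqrt_divide_self_eq inverse_eq_divide)
    finally have 1: "2 * sqrt n * p / (vertex_degree n f i + vertex_degree n f j) \<le> 2 / sqrt n" .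
    have 2: "0 \<le> 2 * sqrt n * p / (vertex_degree n f i + vertex_degree n f j)"
      using d np p by (intro divide_nonneg_nonneg) auto
    have "(2 * sqrt n * p / (vertex_degree n f i + vertex_degree n f j))\<^sup>2 \<le> (2 / sqrt n)\<^sup>2"
      using 1 2 by (rule power_mono)
    thus "(scaled_harmonic n p f i j)\<^sup>2 \<le> 4 / n"
      by (simp add: scaled_harmonic_entry ij power_divide)
  qed
  also have "\<dots> = 4 * n" using n by simp
  finally show ?thesis .
qed

text \<open>Off the diagonal the two matrices differ by \<open>p / sqrt n\<close> and, at edges, by a relative error of
  the degrees divided by \<open>sqrt n\<close>. The first difference is extended to the diagonal to get a constant
  matrix, and the correction for that is absorbed in the part of small Frobenius norm.\<close>

lemma stieltjes_harmonic_near_centered: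
  assumes nr: "near_regular n p f" and p: "0 < p" "p \<le> 1" and t: "t > 0"
  shows "cmod (stieltjes n (scaled_harmonic n p f) t - stieltjes n (centered_adjacency n p f) t)
    \<le> (2 * (real n powr (3/4) + 1) / (n * p) + 2 * p / sqrt n) / t\<^sup>2"
proof -
  define h where "h = 2 * (real n powr (3/4) + 1) / (n * p)"
  have n: "n > 1" using nr unfolding near_regular_def by auto
  have h: "h \<ge> 0" unfolding h_def using p by simp
  define D where "D i j = scaled_harmonic n p f i j - centered_adjacency n p f i j - p / sqrt n" for i j
  have D: "(D i j)\<^sup>2 \<le> h\<^sup>2 / n + p\<^sup>2 / n * of_bool (j = i)" if ij: "i < n" "j < n" for i j
  proof (cases "i = j")
    case True
    thus ?thesis using h by (simp add: D_def scaled_harmonic_entry ij centered_adjacency_def power_divide)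
  next
    case False
    show ?thesis
    proof (cases "f {Suc i, Suc j}")
      case e: True
      define d where "d = vertex_degree n f i + vertex_degree n f j"
      have d: "d \<ge> n * p" "\<bar>2 * (n * p) - d\<bar> \<le> 2 * (real n powr (3/4) + 1)"
        using near_regular_degree[OF nr ij(1)] near_regular_degree[OF nr ij(2)] p unfolding d_def by auto
      have np: "n * p > 0" using n p by simp
      have "D i j = (2 * (n * p) - d) / d / sqrt n"
      proof -
        have "2 * sqrt n * p / d = 2 * (n * p) / d / sqrt n"
        proof -
          have "2 * (n * p) / d / sqrt n = 2 * p / d * (n / sqrt n)" by simp
          thus ?thesis by (simp add: real_div_sqrt)
        qed
        thus ?thesis using d(1) np False e
          by (simp add: D_def scaled_harmonic_entry ij centered_adjacency_def d_def[symmetric] diff_divide_distrib)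
      qed
      also have "\<bar>\<dots>\<bar> = \<bar>2 * (n * p) - d\<bar> / d / sqrt n" using d(1) np by simp
      also have "\<dots> \<le> 2 * (real n powr (3/4) + 1) / (n * p) / sqrt n"
        using d np by (intro divide_right_mono frac_le) auto
      finally have "\<bar>D i j\<bar> \<le> h / sqrt n" unfolding h_def .
      hence "(D i j)\<^sup>2 \<le> (h / sqrt n)\<^sup>2" by (metis abs_ge_zero power2_abs power_mono)
      thus ?thesis using False by (simp add: power_divide)
    next
      case ne: False
      thus ?thesis using False
        by (simp add: D_def scaled_harmonic_entry ij centered_adjacency_def)
    qed
  qed
  have "(\<Sum>i<n. \<Sum>j<n. (D i j)\<^sup>2) \<le> (\<Sum>i<n. \<Sum>j<n. h\<^sup>2 / n + p\<^sup>2 / n * of_bool (j = i))"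
    by (intro sum_mono D) auto
  also have "\<dots> = (\<Sum>i<n. n * (h\<^sup>2 / n) + p\<^sup>2 / n)"
    by (intro sum.cong refl)
       (simp only: sum.distrib lessThan_iff sum_mult_of_bool_eq sum_constant card_lessThan)
  also have "\<dots> = n * h\<^sup>2 + p\<^sup>2" using n by (simp add: distrib_left)
  finally have "(\<Sum>i<n. \<Sum>j<n. (D i j)\<^sup>2) / n \<le> (n * h\<^sup>2 + p\<^sup>2) / n" by (rule divide_right_mono) simp
  also have "\<dots> = h\<^sup>2 + (p / sqrt n)\<^sup>2" using n by (simp add: add_divide_distrib power_divide)
  also have "\<dots> \<le> (h + p / sqrt n)\<^sup>2" using h p by (simp add: power2_sum)
  finally have S: "sqrt ((\<Sum>i<n. \<Sum>j<n. (D i j)\<^sup>2) / n) \<le> h + p / sqrt n"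
    using h p by (intro real_le_lsqrt) auto
  have "cmod (stieltjes n (scaled_harmonic n p f) t - stieltjes n (centered_adjacency n p f) t)
    \<le> (sqrt ((\<Sum>i<n. \<Sum>j<n. (D i j)\<^sup>2) / n) + \<bar>p / sqrt n\<bar>) / t\<^sup>2"
    by (rule stieltjes_perturbation[OF _ t scaled_harmonic_sym centered_adjacency_sym])
       (use n in \<open>auto simp: D_def\<close>)
  also have "\<dots> \<le> (h + p / sqrt n + p / sqrt n) / t\<^sup>2"
    using S p by (intro divide_right_mono add_mono) auto
  finally show ?thesis unfolding h_def by (simp add: add.commute)
qed

section \<open>Absolute values as integrals over the imaginary axis\<close>

lemma has_bochner_integral_FTC_atLeast:
  fixes f F :: "real \<Rightarrow> real"
  assumes f: "f \<in> borel_measurable borel" "\<And>x. a \<le> x \<Longrightarrow> 0 \<le> f x"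
    and F: "\<And>x. a \<le> x \<Longrightarrow> (F has_real_derivative f x) (at x)" and lim: "(F \<longlongrightarrow> T) at_top"
  shows "has_bochner_integral lborel (\<lambda>x. f x * indicator {a..} x) (T - F a)"
proof (rule has_bochner_integral_nn_integral)
  show "(\<lambda>x. f x * indicator {a..} x) \<in> borel_measurable lborel" using f(1) by simp
  show "AE x in lborel. 0 \<le> f x * indicator {a..} x"
    using f(2) by (intro AE_I2) (auto simp: indicator_def)
  have "F a \<le> T"
  proof (rule tendsto_lowerbound[OF lim])
    have "F a \<le> F x" if "a \<le> x" for x
      by (rule DERIV_nonneg_imp_nondecreasing[OF that]) (use F f(2) in blast)
    thus "\<forall>\<^sub>F x in at_top. F a \<le> F x" by (auto simp: eventually_at_top_linorder)
  qed simp
  thus "0 \<le> T - F a" by simp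
  have "(\<integral>\<^sup>+ x. ennreal (f x * indicator {a..} x) \<partial>lborel) = (\<integral>\<^sup>+ x. ennreal (f x) * indicator {a..} x \<partial>lborel)"
    by (intro nn_integral_cong) (auto simp: indicator_def)
  also have "\<dots> = T - F a" by (rule nn_integral_FTC_atLeast[OF f(1) F f(2) lim])
  finally show "(\<integral>\<^sup>+ x. ennreal (f x * indicator {a..} x) \<partial>lborel) = ennreal (T - F a)" .
qed

lemma abs_as_integral:
  fixes x :: real
  shows "has_bochner_integral lborel (\<lambda>t. x\<^sup>2 / (x\<^sup>2 + t\<^sup>2) * indicator {0..} t) (pi / 2 * \<bar>x\<bar>)"
proof (cases "x = 0")
  case True
  thus ?thesis by (simp add: has_bochner_integral_zero)
next
  case False
  define y where "y = \<bar>x\<bar>"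
  have y: "y > 0" "x\<^sup>2 = y\<^sup>2" using False unfolding y_def by auto
  have nz: "y\<^sup>2 + t\<^sup>2 \<noteq> 0" for t using y by (simp add: add_pos_nonneg less_imp_neq[symmetric])
  have "has_bochner_integral lborel (\<lambda>t. y\<^sup>2 / (y\<^sup>2 + t\<^sup>2) * indicator {0..} t) (y * (pi / 2) - y * arctan (0 / y))"
  proof (rule has_bochner_integral_FTC_atLeast)
    show "((\<lambda>t. y * arctan (t / y)) has_real_derivative y\<^sup>2 / (y\<^sup>2 + t\<^sup>2)) (at t)" for t
      using y nz[of t] by (auto intro!: derivative_eq_intros simp: field_simps power2_eq_square add_nonneg_eq_0_iff)
    show "((\<lambda>t. y * arctan (t / y)) \<longlongrightarrow> y * (pi / 2)) at_top"
      using y(1) by real_asymp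
  qed auto
  thus ?thesis unfolding y by (simp add: y_def mult.commute)
qed

text \<open>The antiderivative \<open>t + t ^ 3 / (6 * v) - (t\<^sup>2 + 4 * v) powr (3/2) / (6 * v)\<close> tends to 0 at
  infinity and equals \<open>- 4 / 3 * sqrt v\<close> at 0.\<close>

lemma semicircle_transform_integral:
  assumes v: "v > 0"
  shows "has_bochner_integral lborel (\<lambda>t. (1 - t * semicircle_height v t) * indicator {0..} t) (4 / 3 * sqrt v)"
proof -
  define F where "F t = t + t ^ 3 / (6 * v) - (t\<^sup>2 + 4 * v) * sqrt (t\<^sup>2 + 4 * v) / (6 * v)" for t
  have pos: "t\<^sup>2 + 4 * v > 0" for t :: real using v by (simp add: add_nonneg_pos)
  have "has_bochner_integral lborel (\<lambda>t. (1 - t * semicircle_height v t) * indicator {0..} t) (0 - F 0)"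
  proof (rule has_bochner_integral_FTC_atLeast)
    show "(\<lambda>t. 1 - t * semicircle_height v t) \<in> borel_measurable borel"
      unfolding semicircle_height_def by measurable
    show "0 \<le> 1 - t * semicircle_height v t" if "0 \<le> t" for t
    proof -
      have "t * sqrt (t\<^sup>2 + 4 * v) \<le> t\<^sup>2 + 2 * v"
      proof (rule power2_le_imp_le)
        have "(t * sqrt (t\<^sup>2 + 4 * v))\<^sup>2 = t\<^sup>2 * (t\<^sup>2 + 4 * v)" using pos[of t] by (simp add: power_mult_distrib)
        also have "\<dots> \<le> (t\<^sup>2 + 2 * v)\<^sup>2" by (simp add: power2_eq_square algebra_simps)
        finally show "(t * sqrt (t\<^sup>2 + 4 * v))\<^sup>2 \<le> (t\<^sup>2 + 2 * v)\<^sup>2" .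
      qed (use v in simp)
      thus ?thesis unfolding semicircle_height_def using v by (simp add: field_simps power2_eq_square)
    qed
    show "(F has_real_derivative 1 - t * semicircle_height v t) (at t)" for t
    proof -
      define r where "r = sqrt (t\<^sup>2 + 4 * v)"
      have r: "r > 0" "r * r = t\<^sup>2 + 4 * v" unfolding r_def using pos[of t] by auto
      define g where "g t = sqrt (t\<^sup>2 + 4 * v)" for t
      have D: "(g has_real_derivative t / r) (at t)" and gt: "g t = r"
        unfolding g_def r_def using pos[of t] by (auto intro!: derivative_eq_intros simp: field_simps)
      have F: "F = (\<lambda>t. t + t ^ 3 / (6 * v) - (t\<^sup>2 + 4 * v) * g t / (6 * v))"
        unfolding F_def g_def ..
      have "(F has_real_derivative 1 + 3 * t\<^sup>2 / (6 * v) - (2 * t * r + (t\<^sup>2 + 4 * v) * (t / r)) / (6 * v)) (at t)"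
        unfolding F using v by (auto intro!: derivative_eq_intros D simp: gt)
          (use v r(1) in \<open>simp add: field_simps\<close>)
      also have "(t\<^sup>2 + 4 * v) * (t / r) = t * r" unfolding r(2)[symmetric] using r(1) by simp
      also have "1 + 3 * t\<^sup>2 / (6 * v) - (2 * t * r + t * r) / (6 * v) = 1 - t * semicircle_height v t"
        unfolding semicircle_height_def r_def[symmetric] using v by (simp add: field_simps power2_eq_square)
      finally show ?thesis .
    qed
    show "(F \<longlongrightarrow> 0) at_top" unfolding F_def using v by real_asymp
  qed
  also have "0 - F 0 = 4 / 3 * sqrt v"
    using v unfolding F_def by (simp add: real_sqrt_mult)
  finally show ?thesis .
qed

section \<open>Convergence of the energy\<close>

lemma harmonic_spectral_data:
  "\<exists>u \<mu>. spectral_data n (scaled_harmonic n p f) u \<mu> \<and>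
     (\<Sum>k<n. \<bar>\<mu> k\<bar>) = \<bar>sqrt n * p\<bar> * energy (harmonic_matrix n (edges_of n f))"
proof -
  let ?H = "harmonic_matrix n (edges_of n f)"
  have H: "?H \<in> carrier_mat n n" unfolding harmonic_matrix_def by simp
  have "transpose_mat ?H = ?H"
    unfolding harmonic_matrix_def by (intro eq_matI) (auto simp: insert_commute add.commute)
  then obtain u la where u: "spectral_data n (\<lambda>i j. ?H $$ (i,j)) u la" "energy ?H = (\<Sum>k<n. \<bar>la k\<bar>)"
    using spectral_data_exists[OF H] by blast
  from spectral_data_scale[OF u(1), of "sqrt n * p"]
  have "spectral_data n (scaled_harmonic n p f) u (\<lambda>k. sqrt n * p * la k)"
    unfolding scaled_harmonic_def[abs_def] .
  moreover have "(\<Sum>k<n. \<bar>sqrt n * p * la k\<bar>) = \<bar>sqrt n * p\<bar> * energy ?H"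
    unfolding u(2) by (simp add: abs_mult sum_distrib_left)
  ultimately show ?thesis by blast
qed

text \<open>The function whose integral over \<open>t > 0\<close> is \<open>pi / 2\<close> times the mean absolute eigenvalue.\<close>

definition energy_density :: "nat \<Rightarrow> real \<Rightarrow> (nat set \<Rightarrow> bool) \<Rightarrow> real \<Rightarrow> real" where
  "energy_density n p f t = 1 - t * Im (stieltjes n (scaled_harmonic n p f) t)"

lemma energy_density_sum:
  assumes n: "n > 0" and S: "spectral_data n (scaled_harmonic n p f) u \<mu>" and t: "t > 0"
  shows "energy_density n p f t = (\<Sum>k<n. (\<mu> k)\<^sup>2 / ((\<mu> k)\<^sup>2 + t\<^sup>2)) / n"
proof -
  have e: "x\<^sup>2 / (x\<^sup>2 + t\<^sup>2) = 1 - t * (t / (x\<^sup>2 + t\<^sup>2))" for x :: real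
  proof -
    have "x\<^sup>2 + t\<^sup>2 > 0" using t by (simp add: add_nonneg_pos)
    thus ?thesis using t by (simp add: eq_diff_eq power2_eq_square flip: add_divide_distrib)
  qed
  show ?thesis unfolding energy_density_def Im_stieltjes_spectral_data[OF S t] e
    using n by (simp add: sum_subtractf sum_distrib_left diff_divide_distrib)
qed

text \<open>At \<open>t = 0\<close> the resolvent may fail to exist; that point is excluded from the integral.\<close>

lemma energy_density_integral:
  assumes n: "n > 0" and p: "p > 0"
  shows "has_bochner_integral lborel (\<lambda>t. energy_density n p f t * indicator {0<..} t)
     (pi / 2 * (p / sqrt n * energy (harmonic_matrix n (edges_of n f))))"
proof -
  obtain u \<mu> where S: "spectral_data n (scaled_harmonic n p f) u \<mu>"
    and E: "(\<Sum>k<n. \<bar>\<mu> k\<bar>) = \<bar>sqrt n * p\<bar> * energy (harmonic_matrix n (edges_of n f))"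
    using harmonic_spectral_data by blast
  have "has_bochner_integral lborel (\<lambda>t. (\<Sum>k<n. (\<mu> k)\<^sup>2 / ((\<mu> k)\<^sup>2 + t\<^sup>2) * indicator {0..} t) / n)
     ((\<Sum>k<n. pi / 2 * \<bar>\<mu> k\<bar>) / n)"
    by (intro has_bochner_integral_divide_zero has_bochner_integral_sum abs_as_integral)
  also have "(\<Sum>k<n. pi / 2 * \<bar>\<mu> k\<bar>) / n = pi / 2 * (p / sqrt n * energy (harmonic_matrix n (edges_of n f)))"
  proof -
    have "sqrt n / n = 1 / sqrt n" by (simp add: sqrt_divide_self_eq inverse_eq_divide)
    moreover have "(\<Sum>k<n. pi / 2 * \<bar>\<mu> k\<bar>) / n = pi / 2 * (p * energy (harmonic_matrix n (edges_of n f))) * (sqrt n / n)"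
      unfolding sum_distrib_left[symmetric] E using p by simp
    ultimately show ?thesis by simp
  qed
  finally have 1: "has_bochner_integral lborel (\<lambda>t. (\<Sum>k<n. (\<mu> k)\<^sup>2 / ((\<mu> k)\<^sup>2 + t\<^sup>2) * indicator {0..} t) / n)
    (pi / 2 * (p / sqrt n * energy (harmonic_matrix n (edges_of n f))))" .
  have eq: "(\<Sum>k<n. (\<mu> k)\<^sup>2 / ((\<mu> k)\<^sup>2 + t\<^sup>2)) / n * indicator {0<..} t = energy_density n p f t * indicator {0<..} t" for t
    using energy_density_sum[OF n S, of t] by (auto simp: indicator_def)
  have "AE t in lborel. t \<noteq> (0::real)" by (rule AE_lborel_singleton)
  hence ae: "AE t in lborel. (\<Sum>k<n. (\<mu> k)\<^sup>2 / ((\<mu> k)\<^sup>2 + t\<^sup>2) * indicator {0..} t) / n = energy_density n p f t * indicator {0<..} t"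
  proof (rule AE_mp, intro AE_I2 impI)
    fix t :: real assume "t \<noteq> 0"
    hence "indicator {0..} t = (indicator {0<..} t :: real)" by (auto simp: indicator_def)
    thus "(\<Sum>k<n. (\<mu> k)\<^sup>2 / ((\<mu> k)\<^sup>2 + t\<^sup>2) * indicator {0..} t) / n = energy_density n p f t * indicator {0<..} t"
      unfolding eq[symmetric] by (simp add: sum_distrib_right)
  qed
  show ?thesis
  proof (rule has_bochner_integral_cong_AE[THEN iffD1, OF _ _ ae 1])
    show "(\<lambda>t. (\<Sum>k<n. (\<mu> k)\<^sup>2 / ((\<mu> k)\<^sup>2 + t\<^sup>2) * indicator {0..} t) / n) \<in> borel_measurable lborel"
      using 1 by (rule borel_measurable_has_bochner_integral)
    show "(\<lambda>t. energy_density n p f t * indicator {0<..} t) \<in> borel_measurable lborel"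
      unfolding eq[symmetric] by measurable
  qed
qed

text \<open>Each summand \<open>x\<^sup>2 / (x\<^sup>2 + t\<^sup>2)\<close> is at most 1 and at most \<open>x\<^sup>2 / t\<^sup>2\<close>; the mean of \<open>x\<^sup>2\<close> is at
  most 4.\<close>

lemma energy_density_bounds:
  assumes nr: "near_regular n p f" and p: "0 < p" "p \<le> 1" and t: "t > 0"
  shows "0 \<le> energy_density n p f t" "energy_density n p f t \<le> 5 / (1 + t\<^sup>2)"
proof -
  have n: "n > 0" using nr unfolding near_regular_def by auto
  obtain u \<mu> where S: "spectral_data n (scaled_harmonic n p f) u \<mu>"
    using harmonic_spectral_data by blast
  note eq = energy_density_sum[OF n S t]
  show "0 \<le> energy_density n p f t" unfolding eq by (intro divide_nonneg_nonneg sum_nonneg) auto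
  have "(\<Sum>k<n. (\<mu> k)\<^sup>2 / ((\<mu> k)\<^sup>2 + t\<^sup>2)) * (1 + t\<^sup>2) \<le> (\<Sum>k<n. 1 + (\<mu> k)\<^sup>2)"
    unfolding sum_distrib_right
  proof (intro sum_mono)
    fix k
    have pos: "(\<mu> k)\<^sup>2 + t\<^sup>2 > 0" using t by (simp add: add_nonneg_pos)
    have "(\<mu> k)\<^sup>2 * (1 + t\<^sup>2) \<le> (1 + (\<mu> k)\<^sup>2) * ((\<mu> k)\<^sup>2 + t\<^sup>2)"
      by (simp add: algebra_simps)
    thus "(\<mu> k)\<^sup>2 / ((\<mu> k)\<^sup>2 + t\<^sup>2) * (1 + t\<^sup>2) \<le> 1 + (\<mu> k)\<^sup>2"
      using pos by (simp add: pos_divide_le_eq)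
  qed
  also have "\<dots> = n + (\<Sum>i<n. \<Sum>j<n. (scaled_harmonic n p f i j)\<^sup>2)"
    unfolding spectral_data_sum_squares[OF S, symmetric] by (simp add: sum.distrib)
  also have "\<dots> \<le> 5 * n" using scaled_harmonic_sum_squares[OF nr p] by simp
  finally have "energy_density n p f t * (1 + t\<^sup>2) \<le> 5"
    unfolding eq using n by (simp add: pos_divide_le_eq)
  thus "energy_density n p f t \<le> 5 / (1 + t\<^sup>2)"
    by (subst pos_le_divide_eq) (simp_all add: add_pos_nonneg)
qed

text \<open>The equation of \<open>y\<close> gives \<open>1 - t y = v y\<^sup>2\<close> and \<open>t y \<le> 1\<close>, hence the bounds \<open>1\<close> and
  \<open>v / t\<^sup>2\<close>.\<close>

lemma semicircle_density_bounds:
  assumes v: "0 < v" "v \<le> 1" and t: "t > 0"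
  shows "0 \<le> 1 - t * semicircle_height v t" "1 - t * semicircle_height v t \<le> 2 / (1 + t\<^sup>2)"
proof -
  define y where "y = semicircle_height v t"
  have y: "v * y\<^sup>2 + t * y = 1" "y > 0"
    unfolding y_def by (rule semicircle_height_equation[OF v(1)] semicircle_height_pos[OF v(1)])+
  have eq: "1 - t * y = v * y\<^sup>2" using y(1) by simp
  show "0 \<le> 1 - t * semicircle_height v t" unfolding y_def[symmetric] eq using v by simp
  have ty: "0 \<le> t * y" "t * y \<le> 1" using y t v(1) eq by (auto simp: ) (smt (verit) mult_nonneg_nonneg zero_le_power2)
  have "(1 - t * y) * (1 + t\<^sup>2) = (1 - t * y) + v * (t * y)\<^sup>2"
    unfolding distrib_left mult_1_right by (subst (2) eq) (simp add: power_mult_distrib mult_ac)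
  also have "\<dots> \<le> 1 + 1 * 1\<^sup>2" using v ty by (intro add_mono mult_mono power_mono) auto
  finally show "1 - t * semicircle_height v t \<le> 2 / (1 + t\<^sup>2)"
    unfolding y_def[symmetric] by (subst pos_le_divide_eq) (simp_all add: add_pos_nonneg)
qed

context
  fixes p :: real
  assumes p: "0 < p" "p < 1"
begin

abbreviation "edge_var \<equiv> p * (1 - p)"

definition density_error :: "nat \<Rightarrow> (nat set \<Rightarrow> bool) \<Rightarrow> real \<Rightarrow> real" where
  "density_error n f t = of_bool (near_regular n p f) *
     \<bar>energy_density n p f t - (1 - t * semicircle_height edge_var t)\<bar>"

lemma edge_var_bounds: "0 < edge_var" "edge_var \<le> 1" using p by (auto intro: mult_le_one)

lemma density_error_bound:
  assumes t: "t > 0"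
  shows "0 \<le> density_error n f t" "density_error n f t \<le> 5 / (1 + t\<^sup>2)"
proof -
  show "0 \<le> density_error n f t" unfolding density_error_def by simp
  show "density_error n f t \<le> 5 / (1 + t\<^sup>2)"
  proof (cases "near_regular n p f")
    case True
    have "2 / (1 + t\<^sup>2) \<le> 5 / (1 + t\<^sup>2)" by (intro divide_right_mono) auto
    thus ?thesis
      using True energy_density_bounds[OF True p(1) _ t] semicircle_density_bounds[OF edge_var_bounds t] p
      by (simp add: density_error_def abs_le_iff)
  qed (simp add: density_error_def)
qed

text \<open>Pointwise convergence in \<open>t\<close>: the error is at most \<open>t\<close> times the distance of the trace for the
  scaled Harmonic matrix from \<open>i y\<close>, and this passes through the trace for the centered adjacency
  matrix.\<close>

lemma expected_density_error_tendsto: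
  assumes t: "t > 0"
  shows "(\<lambda>n. mean n p (\<lambda>f. density_error n f t)) \<longlonglongrightarrow> 0"
proof (rule tendsto_sandwich[OF _ _ tendsto_const])
  show "\<forall>\<^sub>F n in sequentially. 0 \<le> mean n p (\<lambda>f. density_error n f t)"
    by (intro always_eventually allI integral_nonneg_AE AE_I2 density_error_bound t)
  let ?h = "\<lambda>n::nat. (2 * (real n powr (3/4) + 1) / (n * p) + 2 * p / sqrt n) / t\<^sup>2"
  let ?s = "\<lambda>n::nat. 2 / (sqrt n * t\<^sup>2) + (8 / (sqrt n * t ^ 3) + 3 / (n * t\<^sup>2) + 4 / (n * t ^ 4)) / t"
  show "(\<lambda>n. t * (?h n + ?s n)) \<longlonglongrightarrow> 0" using p t by real_asymp
  show "\<forall>\<^sub>F n in sequentially. mean n p (\<lambda>f. density_error n f t) \<le> t * (?h n + ?s n)"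
    using eventually_gt_at_top[of 0]
  proof eventually_elim
    case (elim n)
    define y where "y = semicircle_height edge_var t"
    let ?sX = "\<lambda>f. stieltjes n (centered_adjacency n p f) t"
    have "mean n p (\<lambda>f. density_error n f t) \<le> mean n p (\<lambda>f. t * (?h n + cmod (?sX f - \<i> * of_real y)))"
    proof (rule integral_mono[OF integrable_edge_pmf integrable_edge_pmf])
      fix f
      let ?sH = "stieltjes n (scaled_harmonic n p f) t"
      have h: "?h n \<ge> 0" using p by (intro divide_nonneg_nonneg add_nonneg_nonneg) auto
      show "density_error n f t \<le> t * (?h n + cmod (?sX f - \<i> * of_real y))"
      proof (cases "near_regular n p f")
        case True
        have "density_error n f t = \<bar>t * Im (?sH - \<i> * of_real y)\<bar>"
          using True by (simp add: density_error_def energy_density_def y_def algebra_simps)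
        also have "\<dots> = t * \<bar>Im (?sH - \<i> * of_real y)\<bar>" using t by (simp add: abs_mult)
        also have "\<dots> \<le> t * cmod (?sH - \<i> * of_real y)"
          using t by (intro mult_left_mono abs_Im_le_cmod) auto
        also have "cmod (?sH - \<i> * of_real y) \<le> cmod (?sH - ?sX f) + cmod (?sX f - \<i> * of_real y)"
          using norm_triangle_ineq[of "?sH - ?sX f" "?sX f - \<i> * of_real y"] by simp
        also have "cmod (?sH - ?sX f) \<le> ?h n"
          by (rule stieltjes_harmonic_near_centered[OF True _ _ t]) (use p in auto)
        finally show ?thesis using t by simp
      next
        case False
        thus ?thesis using t h by (simp add: density_error_def)
      qed
    qed
    also have "\<dots> = t * (?h n + mean n p (\<lambda>f. cmod (?sX f - \<i> * of_real y)))"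
      by (simp add: integrable_edge_pmf)
    also have "\<dots> \<le> t * (?h n + ?s n)"
      using stieltjes_mean_error[OF elim p t] t unfolding y_def by (intro mult_left_mono add_left_mono) auto
    finally show ?case .
  qed
qed

text \<open>Integrating the error in \<open>t\<close> controls the error of the energy.\<close>

lemma density_error_integral:
  assumes n: "n > 0"
  shows "integrable lborel (\<lambda>t. density_error n f t * indicator {0<..} t)"
    and "of_bool (near_regular n p f) * (pi / 2 * \<bar>p / sqrt n * energy (harmonic_matrix n (edges_of n f)) - 8 / (3 * pi) * sqrt edge_var\<bar>)
      \<le> (\<integral>t. density_error n f t * indicator {0<..} t \<partial>lborel)"
proof -
  note e = energy_density_integral[OF n p(1), of f]
  have "AE t in lborel. t \<noteq> (0::real)" by (rule AE_lborel_singleton)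
  hence ae: "AE t in lborel. (1 - t * semicircle_height edge_var t) * indicator {0..} t = (1 - t * semicircle_height edge_var t) * indicator {0<..} t"
    by (rule AE_mp, intro AE_I2) (auto simp: indicator_def)
  have s: "has_bochner_integral lborel (\<lambda>t. (1 - t * semicircle_height edge_var t) * indicator {0<..} t) (4 / 3 * sqrt edge_var)"
    by (rule has_bochner_integral_cong_AE[THEN iffD1, OF _ _ ae semicircle_transform_integral[OF edge_var_bounds(1)]])
       (unfold semicircle_height_def, measurable)
  let ?D = "\<lambda>t. energy_density n p f t * indicator {0<..} t - (1 - t * semicircle_height edge_var t) * indicator {0<..} t"
  note D = has_bochner_integral_diff[OF e s]
  have eq: "density_error n f t * indicator {0<..} t = of_bool (near_regular n p f) * \<bar>?D t\<bar>" for t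
    unfolding density_error_def by (auto simp: indicator_def)
  have iD: "integrable lborel (\<lambda>t. \<bar>?D t\<bar>)" using integrable.intros[OF D] by (rule integrable_abs)
  show "integrable lborel (\<lambda>t. density_error n f t * indicator {0<..} t)"
    unfolding eq using iD by simp
  have "\<bar>\<integral>t. ?D t \<partial>lborel\<bar> \<le> (\<integral>t. \<bar>?D t\<bar> \<partial>lborel)"
    using integral_norm_bound[of lborel ?D] by simp
  hence "\<bar>pi / 2 * (p / sqrt n * energy (harmonic_matrix n (edges_of n f))) - 4 / 3 * sqrt edge_var\<bar> \<le> (\<integral>t. \<bar>?D t\<bar> \<partial>lborel)"
    unfolding has_bochner_integral_integral_eq[OF D] .
  moreover have "\<bar>pi / 2 * (p / sqrt n * energy (harmonic_matrix n (edges_of n f))) - 4 / 3 * sqrt edge_var\<bar> =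
    pi / 2 * \<bar>p / sqrt n * energy (harmonic_matrix n (edges_of n f)) - 8 / (3 * pi) * sqrt edge_var\<bar>"
  proof -
    have "pi / 2 * X - 4 / 3 * s = pi / 2 * (X - 8 / (3 * pi) * s)" for X s :: real
      by (simp add: field_simps)
    thus ?thesis by (simp only: abs_mult) simp
  qed
  ultimately show "of_bool (near_regular n p f) * (pi / 2 * \<bar>p / sqrt n * energy (harmonic_matrix n (edges_of n f)) - 8 / (3 * pi) * sqrt edge_var\<bar>)
      \<le> (\<integral>t. density_error n f t * indicator {0<..} t \<partial>lborel)"
    unfolding eq by (cases "near_regular n p f") auto
qed

lemma expectation_finite_sum:
  "mean n p F = (\<Sum>f\<in>set_pmf (edge_pmf n p). F f * pmf (edge_pmf n p) f)"
  by (rule integral_measure_pmf_real[OF finite_set_bernoulli_product[OF finite_all_edges]]) auto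

lemma expected_integrated_density_error_tendsto:
  "(\<lambda>n. mean n p (\<lambda>f. \<integral>t. density_error n f t * indicator {0<..} t \<partial>lborel)) \<longlonglongrightarrow> 0"
proof -
  have int: "integrable lborel (\<lambda>t. mean n p (\<lambda>f. density_error n f t * indicator {0<..} t))"
    and swap: "(\<integral>t. mean n p (\<lambda>f. density_error n f t * indicator {0<..} t) \<partial>lborel) =
       mean n p (\<lambda>f. \<integral>t. density_error n f t * indicator {0<..} t \<partial>lborel)" if n: "n > 0" for n
    unfolding expectation_finite_sum using density_error_integral(1)[OF n]
    by (simp_all add: Bochner_Integration.integral_sum)
  (* The limit is taken along Suc n, where there is at least one vertex and the swap applies. *)
  define g where "g n t = mean n p (\<lambda>f. density_error n f t * indicator {0<..} t)" for n t
  have "(\<lambda>n. \<integral>t. g (Suc n) t \<partial>lborel) \<longlonglongrightarrow> (\<integral>t. 0 \<partial>(lborel :: real measure))"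
  proof (rule integral_dominated_convergence)
    show "integrable lborel (\<lambda>t. 5 * (1\<^sup>2 / (1\<^sup>2 + t\<^sup>2) * indicator {0..} t) :: real)"
      using abs_as_integral[of 1] by (intro integrable_mult_right) (rule integrable.intros)
    show "g (Suc n) \<in> borel_measurable lborel" for n
      using int[of "Suc n"] unfolding g_def by (intro borel_measurable_integrable) simp
    show "AE t in lborel. (\<lambda>n. g (Suc n) t) \<longlonglongrightarrow> 0"
    proof (rule AE_I2)
      fix t :: real
      show "(\<lambda>n. g (Suc n) t) \<longlonglongrightarrow> 0"
      proof (cases "t > 0")
        case True
        thus ?thesis using LIMSEQ_Suc[OF expected_density_error_tendsto[OF True]] by (simp add: g_def)
      qed (simp add: g_def)
    qed
    show "AE t in lborel. norm (g (Suc n) t) \<le> 5 * (1\<^sup>2 / (1\<^sup>2 + t\<^sup>2) * indicator {0..} t)" for n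
    proof (rule AE_I2)
      fix t :: real
      show "norm (g (Suc n) t) \<le> 5 * (1\<^sup>2 / (1\<^sup>2 + t\<^sup>2) * indicator {0..} t)"
      proof (cases "t > 0")
        case True
        have "0 \<le> g (Suc n) t" unfolding g_def using True
          by (intro integral_nonneg_AE AE_I2) (simp add: density_error_bound)
        moreover have "g (Suc n) t \<le> mean (Suc n) p (\<lambda>_. 5 / (1 + t\<^sup>2))" unfolding g_def using True
          by (intro integral_mono integrable_edge_pmf) (simp add: density_error_bound)
        ultimately show ?thesis using True by simp
      qed (simp add: g_def)
    qed
  qed simp_all
  hence "(\<lambda>n. mean (Suc n) p (\<lambda>f. \<integral>t. density_error (Suc n) f t * indicator {0<..} t \<partial>lborel)) \<longlonglongrightarrow> 0"
    unfolding g_def swap[OF zero_less_Suc] by simp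
  thus ?thesis by (rule LIMSEQ_imp_Suc)
qed

lemma prob_not_near_regular_tendsto:
  "(\<lambda>n. measure_pmf.prob (edge_pmf n p) {f. \<not> near_regular n p f}) \<longlonglongrightarrow> 0"
proof (rule tendsto_sandwich[OF _ _ tendsto_const])
  have "\<forall>\<^sub>F n::nat in sequentially. real n powr (3/4) + 1 \<le> n * p / 2"
    using p by real_asymp
  with eventually_gt_at_top[of 1]
  show "\<forall>\<^sub>F n in sequentially. measure_pmf.prob (edge_pmf n p) {f. \<not> near_regular n p f}
      \<le> n * (2 * exp (- 2 * sqrt n))"
  proof eventually_elim
    case (elim n)
    thus ?case using p by (intro prob_not_near_regular) auto
  qed
  show "(\<lambda>n. real n * (2 * exp (- 2 * sqrt n))) \<longlonglongrightarrow> 0" by real_asymp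
qed auto

end

theorem corollary11:
  fixes p :: real
  assumes "0 < p" and "p < 1"
  shows "\<forall>\<epsilon>>0. (\<lambda>n. measure_pmf.prob (Gnp n p)
           {G. \<bar>energy (harmonic_matrix n G) /
                 (8 / (3 * pi) * sqrt ((1 - p) / p) * real n powr (1 / 2)) - 1\<bar> > \<epsilon>})
         \<longlonglongrightarrow> 0"
proof (intro allI impI)
  fix \<epsilon> :: real assume \<epsilon>: "\<epsilon> > 0"
  note p = assms
  define C where "C = 8 / (3 * pi) * sqrt ((1 - p) / p)"
  (* the limit of p / sqrt n times the energy *)
  define K where "K = 8 / (3 * pi) * sqrt (p * (1 - p))"
  have C: "C > 0" and K: "K > 0" unfolding C_def K_def using p by auto
  have KC: "K = p * C"
  proof -
    have "p * (1 - p) = p\<^sup>2 * ((1 - p) / p)" using p by (simp add: power2_eq_square)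
    hence "sqrt (p * (1 - p)) = p * sqrt ((1 - p) / p)" using p by (simp only: real_sqrt_mult real_sqrt_abs)
    thus ?thesis unfolding K_def C_def by simp
  qed
  let ?P = "\<lambda>n. edge_pmf n p"
  let ?I = "\<lambda>n f. \<integral>t. density_error p n f t * indicator {0<..} t \<partial>lborel"
  let ?S = "\<lambda>n. {G. \<bar>energy (harmonic_matrix n G) / (C * real n powr (1 / 2)) - 1\<bar> > \<epsilon>}"
  have "(\<lambda>n. measure_pmf.prob (Gnp n p) (?S n)) \<longlonglongrightarrow> 0"
  proof (rule tendsto_sandwich[OF _ _ tendsto_const])
    let ?B = "\<lambda>n. measure_pmf.prob (?P n) {f. \<not> near_regular n p f} +
         mean n p (?I n) * (2 / (pi * (\<epsilon> * K)))"
    show "?B \<longlonglongrightarrow> 0"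
      by (rule tendsto_eq_intros prob_not_near_regular_tendsto[OF p]
          expected_integrated_density_error_tendsto[OF p] tendsto_const refl)+ simp
    show "\<forall>\<^sub>F n in sequentially. measure_pmf.prob (Gnp n p) (?S n) \<le> ?B n"
      using eventually_gt_at_top[of 0]
    proof eventually_elim
      case (elim n)
      note int = integrable_edge_pmf[of n p]
      have "measure_pmf.prob (Gnp n p) (?S n) = measure_pmf.prob (?P n) {f. edges_of n f \<in> ?S n}"
        unfolding Gnp_def measure_map_pmf by (simp add: vimage_def edges_of_def)
      also have "\<dots> = mean n p (indicator {f. edges_of n f \<in> ?S n})"
        by simp
      also have "\<dots> \<le> mean n p
          (\<lambda>f. indicator {f. \<not> near_regular n p f} f + ?I n f * (2 / (pi * (\<epsilon> * K))))"
      proof (rule integral_mono[OF int int])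
        fix f
        have I: "?I n f \<ge> 0"
          using density_error_bound(1)[OF p] by (intro integral_nonneg_AE AE_I2) (auto simp: indicator_def)
        hence I': "?I n f * (2 / (pi * (\<epsilon> * K))) \<ge> 0" using \<epsilon> K by simp
        show "indicator {f. edges_of n f \<in> ?S n} f \<le>
           (indicator {f. \<not> near_regular n p f} f + ?I n f * (2 / (pi * (\<epsilon> * K))) :: real)"
        proof (cases "near_regular n p f \<and> edges_of n f \<in> ?S n")
          case True
          define E where "E = energy (harmonic_matrix n (edges_of n f))"
          have "\<epsilon> < \<bar>E / (C * sqrt n) - 1\<bar>" using True unfolding E_def by (simp add: powr_half_sqrt)
          also have "E / (C * sqrt n) - 1 = (p / sqrt n * E - K) / K"
            unfolding KC using p C elim by (simp add: field_simps)
          finally have "\<epsilon> * K < \<bar>p / sqrt n * E - K\<bar>" using K by (simp add: abs_divide pos_less_divide_eq)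
          hence "pi / 2 * (\<epsilon> * K) \<le> pi / 2 * \<bar>p / sqrt n * E - K\<bar>" by (intro mult_left_mono) auto
          also have "\<dots> \<le> ?I n f"
            using density_error_integral(2)[OF p elim, of f] True unfolding K_def E_def by simp
          finally have "1 \<le> ?I n f * (2 / (pi * (\<epsilon> * K)))"
            using \<epsilon> K by (simp add: pos_le_divide_eq field_simps)
          thus ?thesis using True by simp
        next
          case False
          thus ?thesis using I' by (auto simp: indicator_def)
        qed
      qed
      also have "\<dots> = ?B n" by (simp add: int)
      finally show ?case .
    qed
  qed auto
  thus "(\<lambda>n. measure_pmf.prob (Gnp n p)
           {G. \<bar>energy (harmonic_matrix n G) /
                 (8 / (3 * pi) * sqrt ((1 - p) / p) * real n powr (1 / 2)) - 1\<bar> > \<epsilon>})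
         \<longlonglongrightarrow> 0"
    unfolding C_def .
qed

end
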